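(* Choose $u\leq v$ in $S_n$, and for each $1\leq k\leq n-1$ define the matroid $$\mathcal{M}_k=\Big\{I\in\tbinom{[n]}{k}\ \Big|\ \text{there exists } z\in[u,v]\text{ such that } I=\{z(1),\dots,z(k)\}\Big\}.$$ Then $$\mathsf{Q}_{u,v}=\Big\{\mathbf{x}\in\mathbb{R}^n\ \Big|\ \sum_{i\in[n]}x_i=\binom{n+1}{2},\ \ \sum_{i\in A}x_i\leq\sum_{j=1}^{n-1}r_{\mathcal{M}_j}(A)\ \text{ for all } A\subset[n]\Big\}.$$
   Context: $S_n$ is the symmetric group on $[n]=\{1,\dots,n\}$ with the (strong) Bruhat order $\leq$, and $[u,v]=\{z\in S_n: u\leq z\leq v\}$. Each $z\in S_n$ is identified with the vector $(z(1),\dots,z(n))\in\mathbb{R}^n$; the Bruhat interval polytope $\mathsf{Q}_{u,v}$ is the convex hull of all vectors $(z(1),\dots,z(n))$ with $z\in[u,v]$. $\binom{[n]}{k}$ denotes the collection of $k$-element subsets of $[n]$. A matroid of rank $k$ on $[n]$ is given by its set of bases, a nonempty collection $\mathcal{M}$ of $k$-element subsets of $[n]$ such that for distinct $I,J\in\mathcal{M}$ and $i\in I\setminus J$ there is $j\in J\setminus I$ with $(I\setminus\{i\})\cup\{j\}\in\mathcal{M}$. The rank function of a matroid $\mathcal{M}$ is $r_{\mathcal{M}}(A)=\max_{I\in\mathcal{M}}|A\cap I|$ for $A\subset[n]$.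
   Formalization: As printed the claim is false (A=[n] makes the right side empty). Corrected: the bases of M_k are I={z^{-1}(n),…,z^{-1}(n-k+1)} instead of {z(1),…,z(k)}, and the bound on the sum of x_i over A is |A| plus the sum of r_{M_j}(A) for j=1,…,n-1. *)

theory Defs
  imports "HOL-Analysis.Analysis" "HOL-Combinatorics.Permutations"
begin

(* Elements of S_n are functions w :: nat => nat with "w permutes {1..n}". *)

definition inversions :: "nat \<Rightarrow> (nat \<Rightarrow> nat) \<Rightarrow> nat" where
  "inversions n w = card {(i, j). 1 \<le> i \<and> i < j \<and> j \<le> n \<and> w j < w i}"

definition bruhat_step :: "nat \<Rightarrow> (nat \<Rightarrow> nat) \<Rightarrow> (nat \<Rightarrow> nat) \<Rightarrow> bool" where
  "bruhat_step n u w \<longleftrightarrow>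
     u permutes {1..n} \<and>
     (\<exists>i\<in>{1..n}. \<exists>j\<in>{1..n}. w = u \<circ> Transposition.transpose i j) \<and>
     inversions n u < inversions n w"

definition bruhat_le :: "nat \<Rightarrow> (nat \<Rightarrow> nat) \<Rightarrow> (nat \<Rightarrow> nat) \<Rightarrow> bool" where
  "bruhat_le n = (bruhat_step n)\<^sup>*\<^sup>*"

definition bruhat_interval :: "nat \<Rightarrow> (nat \<Rightarrow> nat) \<Rightarrow> (nat \<Rightarrow> nat) \<Rightarrow> (nat \<Rightarrow> nat) set" where
  "bruhat_interval n u v = {z. z permutes {1..n} \<and> bruhat_le n u z \<and> bruhat_le n z v}"

(* The coordinates of real ^ 'n are labelled by a bijection e from {1..n} to the
   index type, so that x_i is x $ e i. *)
definition bruhat_interval_polytope ::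
    "nat \<Rightarrow> (nat \<Rightarrow> 'n::finite) \<Rightarrow> (nat \<Rightarrow> nat) \<Rightarrow> (nat \<Rightarrow> nat) \<Rightarrow> (real ^ 'n) set" where
  "bruhat_interval_polytope n e u v =
     convex hull {y. \<exists>z\<in>bruhat_interval n u v. \<forall>i\<in>{1..n}. y $ e i = real (z i)}"

definition is_matroid :: "'a set \<Rightarrow> nat \<Rightarrow> 'a set set \<Rightarrow> bool" where
  "is_matroid E k \<B> \<longleftrightarrow>
     \<B> \<noteq> {} \<and>
     (\<forall>I\<in>\<B>. I \<subseteq> E \<and> card I = k) \<and>
     (\<forall>I\<in>\<B>. \<forall>J\<in>\<B>. I \<noteq> J \<longrightarrow>
        (\<forall>i\<in>I - J. \<exists>j\<in>J - I. insert j (I - {i}) \<in> \<B>))"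

definition matroid_rank :: "'a set set \<Rightarrow> 'a set \<Rightarrow> nat" where
  "matroid_rank \<B> A = Max ((\<lambda>I. card (A \<inter> I)) ` \<B>)"

(* The bases are I = {z^-1(n), z^-1(n-1), ..., z^-1(n-k+1)}: the positions, not the
   values, of the k largest entries of z.  The literature also uses the sets
   {z(1), ..., z(k)}, but these do not fit the vertex convention (z(1), ..., z(n)).
   If e_I denotes the indicator vector of I and I_k the set attached to z and k, then
   (z(1), ..., z(n)) = e_{I_1} + ... + e_{I_n}, whereas summing the indicator vectors
   of the sets {z(1), ..., z(k)} gives the vector with i-th entry n + 1 - z^-1(i).
   Since I_n = {1..n} has rank function A |-> card A, the matroids for k = 1, ..., n - 1
   bound the sum of x_i over A only up to the additional summand card A. *)
definition bruhat_matroid ::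
    "nat \<Rightarrow> (nat \<Rightarrow> nat) \<Rightarrow> (nat \<Rightarrow> nat) \<Rightarrow> nat \<Rightarrow> nat set set" where
  "bruhat_matroid n u v k =
     {I. I \<subseteq> {1..n} \<and> card I = k \<and>
         (\<exists>z\<in>bruhat_interval n u v. I = inv z ` {n - k + 1..n})}"

end

theory Submission
  imports Defs
begin

text \<open>
  Let \<open>I\<^sub>k(z)\<close> be the set of positions of the \<open>k\<close> largest entries of \<open>z\<close>, so that the
  vector of \<open>z\<close> is the sum of the indicator vectors of \<open>I\<^sub>1(z), \<dots>, I\<^sub>n(z)\<close>. Summing the
  entries of \<open>z\<close> over \<open>A\<close> thus gives the sum of the numbers \<open>|A \<inter> I\<^sub>k(z)|\<close>, and every
  vertex of the polytope satisfies the rank inequalities.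

  All the rest follows from one fact, \<open>bruhat_interval_prefix_maximum\<close>: for every ordering
  \<open>a\<^sub>1, \<dots>, a\<^sub>n\<close> of the positions there is a single \<open>z\<close> in the interval that maximizes
  \<open>|{a\<^sub>1, \<dots>, a\<^sub>m} \<inter> I\<^sub>k(z)|\<close> for all \<open>m\<close> and \<open>k\<close> simultaneously. For the exchange property of
  two bases \<open>I, J\<close> at \<open>i\<close>, list \<open>I - {i}\<close> first, then \<open>J - I\<close>, then the other positions: the
  maximum is attained at a basis that contains \<open>I - {i}\<close> and takes its last element from \<open>J - I\<close>
  (\<open>is_matroid_if_prefix_maximum\<close>). For the polytope, take a point that satisfies the inequalities,
  and a linear functional. If the positions are listed in the order of the coefficients of the
  functional, then the inequalities for the sets \<open>{a\<^sub>1, \<dots>, a\<^sub>m}\<close> are equalities at \<open>z\<close>, and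
  summation by parts (\<open>sum_weighted_ge\<close>) shows that the functional is at least as good at
  \<open>z\<close> as at the point. Hence no hyperplane separates the point from the polytope.

  The fact is proved by local search. Call a pair of positions improvable in \<open>z\<close> if the one that is
  earlier in the ordering holds the smaller entry; exchanging the two entries never decreases a
  number \<open>|{a\<^sub>1, \<dots>, a\<^sub>m} \<inter> I\<^sub>k(z)|\<close>. Hence every element of the interval is dominated by a
  local maximum, an element from which no such exchange stays in the interval, and it suffices that
  the local maximum is unique. Divide the pairs \<open>i < j\<close> into the ascending ones, where \<open>i\<close> precedes
  \<open>j\<close> in the ordering, and the descending ones. Moving up in the Bruhat order along an ascending
  pair is an improvement, and so is moving down along a descending pair. The key is that the
  ascending pairs and the descending pairs can be listed in such a way that any \<open>x \<le> y\<close> are joined by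
  exactly one saturated chain that first uses ascending pairs and then descending pairs, in the order
  of the two lists (\<open>bruhat_factorization\<close>). If \<open>z\<close> is a local maximum of \<open>[u, v]\<close>, the
  chain from \<open>u\<close> to \<open>z\<close> cannot end with a descending step, as undoing this step would be an
  improvement; so it has ascending steps only. In the same way, the chain from \<open>z\<close> to \<open>v\<close>
  has descending steps only. So \<open>z\<close> is the point where the unique chain from \<open>u\<close> to \<open>v\<close> turns
  from ascending to descending steps, which determines \<open>z\<close>.

  To count chains, let \<open>T\<^sub>i\<^sub>j\<close> map a function \<open>f\<close> on permutations to
  \<open>u \<mapsto> f(u) + f(u (i j))\<close>, where the second term is present only if \<open>u (i j)\<close> covers \<open>u\<close>.
  A product of these operators counts the saturated chains whose steps follow a given list of
  pairs. The operators commute for disjoint pairs and satisfy the Yang-Baxter equation, and this is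
  enough to rewrite the product over all pairs in lexicographic order as a product over ascending
  pairs followed by a product over descending pairs (\<open>lex_pairs_factor\<close>). For the lexicographic
  order the chain is unique because its steps are forced: they fix the entries from left to right
  (\<open>bruhat_ops_lex_pairs\<close>).
\<close>

section \<open>Bruhat operators and the Yang-Baxter equation\<close>

text \<open>
  The transposition raises the length by exactly one if no position between the two carries a value
  between the two values. Injectivity is part of the predicate so that
  the relations below hold as equations between operators on all functions, not only at permutations.
\<close>

definition covers :: "nat \<Rightarrow> nat \<Rightarrow> (nat \<Rightarrow> nat) \<Rightarrow> bool" where
  "covers i j u \<longleftrightarrow> inj u \<and> i < j \<and> u i < u j \<and> (\<forall>l. i < l \<and> l < j \<longrightarrow> \<not> (u i < u l \<and> u l < u j))"

text \<open>
  The sum of \<open>f\<close> over the results of an optional step along the pair \<open>(i, j)\<close>. Iterating with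
  \<open>f\<close> the indicator function of a permutation counts chains of optional steps that end there.
\<close>

definition bruhat_op ::
    "nat \<Rightarrow> nat \<Rightarrow> ((nat \<Rightarrow> nat) \<Rightarrow> nat) \<Rightarrow> (nat \<Rightarrow> nat) \<Rightarrow> nat" where
  "bruhat_op i j f u = f u + (if covers i j u then f (u \<circ> Transposition.transpose i j) else 0)"

fun bruhat_ops :: "(nat \<times> nat) list \<Rightarrow> ((nat \<Rightarrow> nat) \<Rightarrow> nat) \<Rightarrow> (nat \<Rightarrow> nat) \<Rightarrow> nat" where
  "bruhat_ops [] = id"
| "bruhat_ops ((i, j) # L) = bruhat_op i j \<circ> bruhat_ops L"

lemma bruhat_ops_append: "bruhat_ops (L @ K) = bruhat_ops L \<circ> bruhat_ops K"
  by (induction L rule: bruhat_ops.induct) auto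

lemma inj_comp_transpose: "inj (u \<circ> Transposition.transpose i j) \<longleftrightarrow> inj (u :: nat \<Rightarrow> nat)"
proof
  assume "inj (u \<circ> Transposition.transpose i j)"
  hence "inj ((u \<circ> Transposition.transpose i j) \<circ> Transposition.transpose i j)"
    by (rule inj_compose) (simp add: bij_is_inj)
  moreover have "(u \<circ> Transposition.transpose i j) \<circ> Transposition.transpose i j = u"
    by (simp add: fun_eq_iff)
  ultimately show "inj u" by simp
qed (simp add: bij_is_inj inj_compose)

text \<open>
  The positions of one pair may lie between those of the other, so each step can change the entries
  that the other one has to avoid. But if both pairs are steps in one order, then the values
  involved cannot interleave in such a way that a step is blocked in the opposite order.
\<close>

lemma covers_disjoint_swap:
  assumes d: "i \<noteq> k" "i \<noteq> l" "j \<noteq> k" "j \<noteq> l"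
    and c: "covers i j u" and c': "covers k l (u \<circ> Transposition.transpose i j)"
  shows "covers k l u \<and> covers i j (u \<circ> Transposition.transpose k l)"
proof -
  have inj: "inj u" and ij: "i < j" "u i < u j" and kl: "k < l" "u k < u l"
    using c c' d by (auto simp: covers_def Transposition.transpose_def)
  have A: "\<not> (u i < u m \<and> u m < u j)" if "i < m" "m < j" for m
    using c that by (auto simp: covers_def)
  have B: "\<not> (u k < u m \<and> u m < u l)" if "k < m" "m < l" "m \<noteq> i" "m \<noteq> j" for m
    using c' that d by (auto simp: covers_def Transposition.transpose_def)
  have B1: "\<not> (u k < u j \<and> u j < u l)" if "k < i" "i < l"
    using c' that d by (auto simp: covers_def Transposition.transpose_def split: if_splits)
  have B2: "\<not> (u k < u i \<and> u i < u l)" if "k < j" "j < l"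
    using c' that d ij by (auto simp: covers_def Transposition.transpose_def split: if_splits)
  have ne: "u i \<noteq> u k" "u i \<noteq> u l" "u j \<noteq> u k" "u j \<noteq> u l"
    using inj d by (auto simp: inj_eq)
  have C1: "\<not> (u k < u i \<and> u i < u l)" if "k < i" "i < l"
    using A[of l] B1 B2 that ij kl ne d by (smt (verit) linorder_neqE_nat less_trans)
  have C2: "\<not> (u k < u j \<and> u j < u l)" if "k < j" "j < l"
    using A[of k] B1 B2 that ij kl ne d by (smt (verit) linorder_neqE_nat less_trans)
  have D1: "\<not> (u i < u l \<and> u l < u j)" if "i < k" "k < j"
    using A[of k] A[of l] B1 B2 C1 C2 that ij kl ne d by (smt (verit) linorder_neqE_nat less_trans)
  have D2: "\<not> (u i < u k \<and> u k < u j)" if "i < l" "l < j"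
    using A[of k] A[of l] B1 B2 C1 C2 that ij kl ne d by (smt (verit) linorder_neqE_nat less_trans)
  have "covers k l u"
    unfolding covers_def using inj kl B C1 C2 by blast
  moreover have "covers i j (u \<circ> Transposition.transpose k l)"
    unfolding covers_def inj_comp_transpose using inj ij d A D1 D2
    by (auto simp: Transposition.transpose_def)
  ultimately show ?thesis ..
qed

lemma bruhat_op_commute:
  assumes d: "i \<noteq> k" "i \<noteq> l" "j \<noteq> k" "j \<noteq> l"
  shows "bruhat_op i j \<circ> bruhat_op k l = bruhat_op k l \<circ> bruhat_op i j"
proof (intro ext)
  fix f and u :: "nat \<Rightarrow> nat"
  have eq: "u \<circ> Transposition.transpose i j \<circ> Transposition.transpose k l = u \<circ> Transposition.transpose k l \<circ> Transposition.transpose i j"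
    using d by (auto simp: fun_eq_iff Transposition.transpose_def)
  have "covers i j u \<and> covers k l (u \<circ> Transposition.transpose i j) \<longleftrightarrow>
      covers k l u \<and> covers i j (u \<circ> Transposition.transpose k l)"
    using covers_disjoint_swap[of i k l j u] covers_disjoint_swap[of k i j l u] d by auto
  thus "(bruhat_op i j \<circ> bruhat_op k l) f u = (bruhat_op k l \<circ> bruhat_op i j) f u"
    unfolding bruhat_op_def o_apply using eq by (auto simp: comp_def)
qed

text \<open>
  Both sides count three optional steps within the positions \<open>i < j < k\<close>. The entries at other
  positions enter only through the values present in the two gaps, so the claim is a finite
  comparison for each of the six relative orders of the three entries.
\<close>

lemma bruhat_op_yang_baxter:
  assumes lt: "i < j" "j < k"
  shows "bruhat_op i j \<circ> bruhat_op i k \<circ> bruhat_op j k = bruhat_op j k \<circ> bruhat_op i k \<circ> bruhat_op i j"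
proof (intro ext)
  fix f u
  show "(bruhat_op i j \<circ> bruhat_op i k \<circ> bruhat_op j k) f u =
      (bruhat_op j k \<circ> bruhat_op i k \<circ> bruhat_op i j) f u"
  proof (cases "inj u")
    case False
    thus ?thesis by (simp add: bruhat_op_def covers_def inj_comp_transpose)
  next
    case inj: True
    define U where "U a b c = u(i := a, j := b, k := c)" for a b c
    define N1 where "N1 a b \<longleftrightarrow> (\<forall>l. i < l \<and> l < j \<longrightarrow> \<not> (a < u l \<and> u l < b))" for a b
    define N2 where "N2 a b \<longleftrightarrow> (\<forall>l. j < l \<and> l < k \<longrightarrow> \<not> (a < u l \<and> u l < b))" for a b
    define x y z where "x = u i" and "y = u j" and "z = u k"
    have u: "u = U x y z" by (simp add: U_def x_def y_def z_def)
    have tr: "U a b c \<circ> Transposition.transpose i j = U b a c" "U a b c \<circ> Transposition.transpose i k = U c b a"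
      "U a b c \<circ> Transposition.transpose j k = U a c b" for a b c
      using lt by (auto simp: U_def fun_eq_iff Transposition.transpose_def)
    note sep = N1_def N2_def
    have Uv: "U a b c i = a" "U a b c j = b" "U a b c k = c" for a b c
      using lt by (auto simp: U_def)
    have Uint: "U a b c l = u l" if "i < l \<and> l < j \<or> j < l \<and> l < k" for a b c l
      using lt that by (auto simp: U_def)
    have interior: "(\<forall>l. i < l \<and> l < j \<longrightarrow> \<not> (d < U a b c l \<and> U a b c l < e)) \<longleftrightarrow> N1 d e"
      "(\<forall>l. j < l \<and> l < k \<longrightarrow> \<not> (d < U a b c l \<and> U a b c l < e)) \<longleftrightarrow> N2 d e" for a b c d e
      unfolding sep by (intro iff_allI imp_cong refl; simp add: Uint)+
    have cU: "covers i j (U a b c) \<longleftrightarrow> inj (U a b c) \<and> a < b \<and> N1 a b"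
      "covers j k (U a b c) \<longleftrightarrow> inj (U a b c) \<and> b < c \<and> N2 b c" for a b c
      unfolding covers_def Uv interior using lt by auto
    \<comment> \<open>The range between i and k consists of the two gaps and the position j itself.\<close>
    have cik: "covers i k (U a b c) \<longleftrightarrow>
        inj (U a b c) \<and> a < c \<and> \<not> (a < b \<and> b < c) \<and> N1 a c \<and> N2 a c" for a b c
    proof -
      have cases: "i < l \<and> l < k \<longleftrightarrow> i < l \<and> l < j \<or> l = j \<or> j < l \<and> l < k" for l
        using lt by auto
      have "(\<forall>l. i < l \<and> l < k \<longrightarrow> P l) \<longleftrightarrow>
          (\<forall>l. i < l \<and> l < j \<longrightarrow> P l) \<and> P j \<and> (\<forall>l. j < l \<and> l < k \<longrightarrow> P l)" for P
        unfolding cases by blast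
      from this[of "\<lambda>l. \<not> (a < U a b c l \<and> U a b c l < c)"] show ?thesis
        unfolding covers_def Uv interior using lt by auto
    qed
    have injU: "inj (U x z y)" "inj (U y x z)" "inj (U y z x)" "inj (U z x y)" "inj (U z y x)" "inj (U x y z)"
      using inj unfolding u by (metis inj_comp_transpose tr)+
    have ne: "x \<noteq> y" "y \<noteq> z" "x \<noteq> z"
      using inj lt by (auto simp: x_def y_def z_def inj_eq)
    \<comment> \<open>A gap avoids an interval of values that contains the third entry exactly if it avoids both
      parts, because no other position carries that entry.\<close>
    have split: "N1 a c \<longleftrightarrow> N1 a b \<and> N1 b c" "N2 a c \<longleftrightarrow> N2 a b \<and> N2 b c"
      if "a < b" "b < c" "b \<in> {x, y, z}" for a b c
    proof -
      have *: "a < u l \<and> u l < c \<longleftrightarrow> a < u l \<and> u l < b \<or> b < u l \<and> u l < c"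
        if "i < l \<and> l < j \<or> j < l \<and> l < k" for l
      proof -
        have "u l \<noteq> b"
          using inj that \<open>b \<in> {x, y, z}\<close> lt by (auto simp: x_def y_def z_def inj_eq)
        thus ?thesis using \<open>a < b\<close> \<open>b < c\<close> by auto
      qed
      show "N1 a c \<longleftrightarrow> N1 a b \<and> N1 b c" "N2 a c \<longleftrightarrow> N2 a b \<and> N2 b c"
        unfolding sep using * by blast+
    qed
    consider "x < y" "y < z" | "x < z" "z < y" | "y < x" "x < z" | "y < z" "z < x"
      | "z < x" "x < y" | "z < y" "y < x"
      using ne by linarith
    thus ?thesis
    proof cases
      case 1
      thus ?thesis using split[of x y z]
        unfolding u bruhat_op_def o_apply tr cU cik by (simp add: injU)
    next
      case 2
      thus ?thesis using split[of x z y]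
        unfolding u bruhat_op_def o_apply tr cU cik by (simp add: injU)
    next
      case 3
      thus ?thesis using split[of y x z]
        unfolding u bruhat_op_def o_apply tr cU cik by (simp add: injU)
    next
      case 4
      thus ?thesis using split[of y z x]
        unfolding u bruhat_op_def o_apply tr cU cik by (simp add: injU)
    next
      case 5
      thus ?thesis using split[of z x y]
        unfolding u bruhat_op_def o_apply tr cU cik by (simp add: injU)
    next
      case 6
      thus ?thesis using split[of z y x]
        unfolding u bruhat_op_def o_apply tr cU cik by (simp add: injU)
    qed
  qed
qed

lemma bruhat_op_commute_ops:
  assumes "\<forall>(k, l) \<in> set L. i \<noteq> k \<and> i \<noteq> l \<and> j \<noteq> k \<and> j \<noteq> l"
  shows "bruhat_op i j \<circ> bruhat_ops L = bruhat_ops L \<circ> bruhat_op i j"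
  using assms
proof (induction L)
  case (Cons t L)
  obtain k l where t: "t = (k, l)" by (cases t)
  have 1: "bruhat_op i j \<circ> bruhat_op k l = bruhat_op k l \<circ> bruhat_op i j"
    using Cons.prems t by (intro bruhat_op_commute) auto
  have 2: "bruhat_op i j \<circ> bruhat_ops L = bruhat_ops L \<circ> bruhat_op i j"
    using Cons.prems by (intro Cons.IH) auto
  have "bruhat_op i j \<circ> bruhat_ops (t # L) = (bruhat_op i j \<circ> bruhat_op k l) \<circ> bruhat_ops L"
    by (simp add: t comp_assoc)
  also have "\<dots> = bruhat_op k l \<circ> (bruhat_op i j \<circ> bruhat_ops L)"
    by (simp only: 1 comp_assoc)
  also have "\<dots> = bruhat_ops (t # L) \<circ> bruhat_op i j"
    by (simp only: 2 t bruhat_ops.simps comp_assoc)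
  finally show ?case .
qed auto

lemma bruhat_ops_commute:
  assumes "\<forall>(i, j) \<in> set K. \<forall>(k, l) \<in> set L. i \<noteq> k \<and> i \<noteq> l \<and> j \<noteq> k \<and> j \<noteq> l"
  shows "bruhat_ops K \<circ> bruhat_ops L = bruhat_ops L \<circ> bruhat_ops K"
  using assms
proof (induction K)
  case (Cons t K)
  obtain i j where t: "t = (i, j)" by (cases t)
  have 1: "bruhat_op i j \<circ> bruhat_ops L = bruhat_ops L \<circ> bruhat_op i j"
    using Cons.prems t by (intro bruhat_op_commute_ops) auto
  have 2: "bruhat_ops K \<circ> bruhat_ops L = bruhat_ops L \<circ> bruhat_ops K"
    using Cons.prems by (intro Cons.IH) auto
  have "bruhat_ops (t # K) \<circ> bruhat_ops L = bruhat_op i j \<circ> (bruhat_ops K \<circ> bruhat_ops L)"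
    by (simp add: t comp_assoc)
  also have "\<dots> = (bruhat_op i j \<circ> bruhat_ops L) \<circ> bruhat_ops K"
    by (simp only: 2 comp_assoc)
  also have "\<dots> = bruhat_ops L \<circ> bruhat_ops (t # K)"
    by (simp only: 1 t bruhat_ops.simps comp_assoc)
  finally show ?case .
qed auto

text \<open>
  Repeated use of the Yang-Baxter equation for the triples \<open>x < a < y\<close>.
\<close>

lemma bruhat_ops_yang_baxter:
  assumes "x < a" "\<forall>y\<in>set ys. a < y" "distinct ys"
  shows "bruhat_op x a \<circ> bruhat_ops (map (Pair x) ys) \<circ> bruhat_ops (map (Pair a) ys) =
    bruhat_ops (map (Pair a) ys) \<circ> bruhat_ops (map (Pair x) ys) \<circ> bruhat_op x a"
  using assms
proof (induction ys)
  case (Cons y ys)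
  let ?X = "bruhat_ops (map (Pair x) ys)" and ?A = "bruhat_ops (map (Pair a) ys)"
  have 1: "bruhat_op a y \<circ> ?X = ?X \<circ> bruhat_op a y"
    using Cons.prems by (intro bruhat_op_commute_ops) auto
  have 2: "bruhat_op x y \<circ> ?A = ?A \<circ> bruhat_op x y"
    using Cons.prems by (intro bruhat_op_commute_ops) auto
  have 3: "bruhat_op x a \<circ> bruhat_op x y \<circ> bruhat_op a y = bruhat_op a y \<circ> bruhat_op x y \<circ> bruhat_op x a"
    using Cons.prems by (intro bruhat_op_yang_baxter) auto
  have 4: "bruhat_op x a \<circ> ?X \<circ> ?A = ?A \<circ> ?X \<circ> bruhat_op x a"
    using Cons.prems by (intro Cons.IH) auto
  have "bruhat_op x a \<circ> (bruhat_op x y \<circ> ?X) \<circ> (bruhat_op a y \<circ> ?A) =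
      bruhat_op x a \<circ> bruhat_op x y \<circ> (?X \<circ> bruhat_op a y) \<circ> ?A"
    by (simp only: comp_assoc)
  also have "\<dots> = (bruhat_op x a \<circ> bruhat_op x y \<circ> bruhat_op a y) \<circ> ?X \<circ> ?A"
    by (simp only: 1[symmetric] comp_assoc)
  also have "\<dots> = bruhat_op a y \<circ> bruhat_op x y \<circ> (bruhat_op x a \<circ> ?X \<circ> ?A)"
    by (simp only: 3) (simp only: comp_assoc)
  also have "\<dots> = bruhat_op a y \<circ> (bruhat_op x y \<circ> ?A) \<circ> ?X \<circ> bruhat_op x a"
    by (simp only: 4) (simp only: comp_assoc)
  also have "\<dots> = (bruhat_op a y \<circ> ?A) \<circ> (bruhat_op x y \<circ> ?X) \<circ> bruhat_op x a"
    by (simp only: 2) (simp only: comp_assoc)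
  finally show ?case by (simp only: list.map bruhat_ops.simps)
qed auto

section \<open>Sorting the pairs by an ordering of the positions\<close>

fun lex_pairs :: "nat list \<Rightarrow> (nat \<times> nat) list" where
  "lex_pairs [] = []"
| "lex_pairs (x # xs) = map (Pair x) xs @ lex_pairs xs"

lemma set_lex_pairs: "(i, j) \<in> set (lex_pairs xs) \<Longrightarrow> i \<in> set xs \<and> j \<in> set xs"
  by (induction xs) auto

lemma insort_split:
  assumes "sorted (xs :: nat list)" "a \<notin> set xs"
  shows "insort a xs = filter (\<lambda>j. j < a) xs @ a # filter (\<lambda>j. a < j) xs"
  using assms
proof (induction xs)
  case (Cons x xs)
  show ?case
  proof (cases "x < a")
    case True
    thus ?thesis using Cons by auto
  next
    case False
    hence "filter (\<lambda>j. j < a) xs = []" "filter (\<lambda>j. a < j) xs = xs"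
      using Cons.prems by (auto simp: filter_empty_conv filter_id_conv)
    thus ?thesis using False Cons.prems by auto
  qed
qed auto

text \<open>
  All pairs that contain one chosen position \<open>a\<close> can be moved out of the lexicographic product: those
  in which \<open>a\<close> is the smaller position to the front and those in which it is the larger one to
  the back. In the induction the first position \<open>x < a\<close> is added. The Yang-Baxter equation moves
  \<open>(x, a)\<close> across the pairs \<open>(x, j)\<close> and \<open>(a, j)\<close> with \<open>j > a\<close>; after that it is disjoint from
  everything that separates it from the back.
\<close>

lemma lex_pairs_insort:
  assumes "sorted xs" "distinct xs" "a \<notin> set xs"
  shows "bruhat_ops (lex_pairs (insort a xs)) =
    bruhat_ops (map (Pair a) (filter (\<lambda>j. a < j) xs)) \<circ> bruhat_ops (lex_pairs xs) \<circ>
    bruhat_ops (map (\<lambda>j. (j, a)) (filter (\<lambda>j. j < a) xs))"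
  using assms
proof (induction xs)
  case (Cons x xs)
  show ?case
  proof (cases "a < x")
    case True
    hence "filter (\<lambda>j. j < a) xs = []" "filter (\<lambda>j. a < j) xs = xs"
      using Cons.prems by (auto simp: filter_empty_conv filter_id_conv)
    thus ?thesis using True Cons.prems by (auto simp: bruhat_ops_append)
  next
    case False
    hence xa: "x < a" using Cons.prems by auto
    define Lo Hi where "Lo = filter (\<lambda>j. j < a) xs" and "Hi = filter (\<lambda>j. a < j) xs"
    let ?XL = "bruhat_ops (map (Pair x) Lo)" and ?XH = "bruhat_ops (map (Pair x) Hi)"
    let ?F = "bruhat_ops (map (Pair a) Hi)" and ?B = "bruhat_ops (map (\<lambda>j. (j, a)) Lo)"
    let ?P = "bruhat_ops (lex_pairs xs)" and ?t = "bruhat_op x a"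
    have xs: "xs = Lo @ Hi" and ins: "insort a xs = Lo @ a # Hi"
    proof -
      show ins: "insort a xs = Lo @ a # Hi"
        unfolding Lo_def Hi_def using Cons.prems by (intro insort_split) auto
      have "remove1 a (insort a xs) = xs" by (rule remove1_insort_key)
      moreover have "a \<notin> set Lo" by (auto simp: Lo_def)
      ultimately show "xs = Lo @ Hi" by (simp add: ins remove1_append)
    qed
    have IH: "bruhat_ops (lex_pairs (insort a xs)) = ?F \<circ> ?P \<circ> ?B"
      using Cons by (auto simp: Lo_def Hi_def)
    have 1: "?t \<circ> ?XH \<circ> ?F = ?F \<circ> ?XH \<circ> ?t"
      using xa Cons.prems by (intro bruhat_ops_yang_baxter) (auto simp: Hi_def)
    have 2: "?XL \<circ> ?F = ?F \<circ> ?XL"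
      using xa Cons.prems by (intro bruhat_ops_commute) (auto simp: Hi_def Lo_def)
    have 3: "?t \<circ> ?P = ?P \<circ> ?t"
      using xa Cons.prems by (intro bruhat_op_commute_ops) (auto dest!: set_lex_pairs)
    have "bruhat_ops (lex_pairs (insort a (x # xs))) = ?XL \<circ> (?t \<circ> ?XH \<circ> ?F) \<circ> ?P \<circ> ?B"
      using xa IH by (simp add: ins bruhat_ops_append comp_assoc)
    also have "\<dots> = (?XL \<circ> ?F) \<circ> ?XH \<circ> (?t \<circ> ?P) \<circ> ?B"
      unfolding 1 by (simp add: comp_assoc)
    also have "\<dots> = ?F \<circ> (?XL \<circ> ?XH \<circ> ?P) \<circ> (?t \<circ> ?B)"
      unfolding 2 3 by (simp add: comp_assoc)
    also have "?XL \<circ> ?XH \<circ> ?P = bruhat_ops (lex_pairs (x # xs))"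
      by (simp add: xs bruhat_ops_append comp_assoc)
    also have "?t \<circ> ?B = bruhat_ops (map (\<lambda>j. (j, a)) (filter (\<lambda>j. j < a) (x # xs)))"
      using xa by (simp add: Lo_def)
    finally show ?thesis using xa by (simp add: Hi_def)
  qed
qed auto

text \<open>
  The pairs that keep their order in the list \<open>as\<close>, and below those that are reversed in it. The
  order within the two lists is the one produced by moving the pairs of each entry of \<open>as\<close> in turn
  to the two ends of the lexicographic product.
\<close>

fun ascending_pairs :: "nat list \<Rightarrow> (nat \<times> nat) list" where
  "ascending_pairs [] = []"
| "ascending_pairs (a # as) = map (Pair a) (filter (\<lambda>j. a < j) (sort as)) @ ascending_pairs as"

fun descending_pairs :: "nat list \<Rightarrow> (nat \<times> nat) list" where
  "descending_pairs [] = []"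
| "descending_pairs (a # as) = descending_pairs as @ map (\<lambda>j. (j, a)) (filter (\<lambda>j. j < a) (sort as))"

lemma lex_pairs_factor:
  "distinct as \<Longrightarrow> bruhat_ops (lex_pairs (sort as)) =
    bruhat_ops (ascending_pairs as) \<circ> bruhat_ops (descending_pairs as)"
proof (induction as)
  case (Cons a as)
  have "bruhat_ops (lex_pairs (sort (a # as))) =
    bruhat_ops (map (Pair a) (filter (\<lambda>j. a < j) (sort as))) \<circ> bruhat_ops (lex_pairs (sort as)) \<circ>
    bruhat_ops (map (\<lambda>j. (j, a)) (filter (\<lambda>j. j < a) (sort as)))"
    using Cons.prems by (simp add: lex_pairs_insort)
  thus ?case using Cons by (simp add: bruhat_ops_append comp_assoc)
qed auto

section \<open>The Bruhat order and its rank criterion\<close>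

text \<open>
  Exchanging two entries so that the larger one arrives at \<open>p\<close> does not lower the number of large
  entries in a set that contains \<open>p\<close> whenever it contains \<open>q\<close>. With \<open>A\<close> an initial segment of
  the positions this shows that the rank criterion is necessary for the Bruhat order; with \<open>A\<close> an initial part of some other
  ordering of the positions it says that improving exchanges improve.
\<close>

lemma card_above_mono:
  fixes u :: "nat \<Rightarrow> nat"
  assumes "finite A" "u p < u q" "q \<in> A \<longrightarrow> p \<in> A"
  shows "card {l \<in> A. h < u l} \<le> card {l \<in> A. h < (u \<circ> Transposition.transpose p q) l}"
proof (cases "q \<in> A")
  case True
  hence "Transposition.transpose p q ` {l \<in> A. h < u l} \<subseteq> {l \<in> A. h < (u \<circ> Transposition.transpose p q) l}"
    using assms(3) by (auto simp: Transposition.transpose_def)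
  hence "card (Transposition.transpose p q ` {l \<in> A. h < u l}) \<le>
      card {l \<in> A. h < (u \<circ> Transposition.transpose p q) l}"
    using assms(1) by (intro card_mono) auto
  thus ?thesis by (simp add: card_image)
next
  case False
  thus ?thesis using assms by (intro card_mono) (auto simp: Transposition.transpose_def)
qed

text \<open>
  The transposition maps an inversion of \<open>u\<close> to an inversion of the new permutation unless it reverses
  the order of the two positions; in that case the pair itself stays an inversion. This embeds the
  inversions of \<open>u\<close> into those of the new permutation and misses the pair \<open>(i, j)\<close>.
\<close>

lemma inversions_less_transpose:
  assumes "i \<in> {1..n}" "j \<in> {1..n}" "i < j" "u i < u j"
  shows "inversions n u < inversions n (u \<circ> Transposition.transpose i j)"
proof -
  let ?t = "Transposition.transpose i j"
  define Inv where "Inv w = {(a, b). 1 \<le> a \<and> a < b \<and> b \<le> n \<and> w b < w a}" for w :: "nat \<Rightarrow> nat"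
  define \<phi> where "\<phi> = (\<lambda>(a, b). if ?t a < ?t b then (?t a, ?t b) else (a, b))"
  have fin: "finite (Inv w)" for w
    by (rule finite_subset[of _ "{1..n} \<times> {1..n}"]) (auto simp: Inv_def)
  have inj: "inj_on \<phi> (Inv u)"
  proof (rule inj_onI; clarify)
    fix a b c d assume ab: "(a, b) \<in> Inv u" and cd: "(c, d) \<in> Inv u" and eq: "\<phi> (a, b) = \<phi> (c, d)"
    have "a < b" "c < d" using ab cd by (auto simp: Inv_def)
    show "a = c \<and> b = d"
    proof (cases "?t a < ?t b"; cases "?t c < ?t d")
      assume "?t a < ?t b" "?t c < ?t d"
      hence "?t a = ?t c" "?t b = ?t d" using eq by (auto simp: \<phi>_def)
      thus ?thesis by (metis transpose_involutory)
    next
      assume *: "?t a < ?t b" "\<not> ?t c < ?t d"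
      hence "c = ?t a" "d = ?t b" using eq by (auto simp: \<phi>_def)
      thus ?thesis using * \<open>a < b\<close> by simp
    next
      assume *: "\<not> ?t a < ?t b" "?t c < ?t d"
      hence "a = ?t c" "b = ?t d" using eq by (auto simp: \<phi>_def)
      thus ?thesis using * \<open>c < d\<close> by simp
    qed (use eq in \<open>auto simp: \<phi>_def\<close>)
  qed
  have sub: "\<phi> ` Inv u \<subseteq> Inv (u \<circ> ?t) - {(i, j)}"
    using assms by (auto simp: \<phi>_def Inv_def Transposition.transpose_def split: if_splits)
  have "card (Inv u) = card (\<phi> ` Inv u)" using inj by (simp add: card_image)
  also have "\<dots> \<le> card (Inv (u \<circ> ?t) - {(i, j)})" using sub fin by (intro card_mono) auto
  also have "\<dots> < card (Inv (u \<circ> ?t))"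
    using assms fin by (intro psubset_card_mono) (auto simp: Inv_def)
  finally show ?thesis by (simp add: inversions_def Inv_def)
qed

lemma bruhat_step_transpose:
  assumes "u permutes {1..n}" "i \<in> {1..n}" "j \<in> {1..n}" "i < j" "u i < u j"
  shows "bruhat_step n u (u \<circ> Transposition.transpose i j)"
  unfolding bruhat_step_def using assms inversions_less_transpose[of i n j u] by blast

lemma bruhat_stepE:
  assumes "bruhat_step n u w"
  obtains i j where "i \<in> {1..n}" "j \<in> {1..n}" "i < j" "u i < u j" "w = u \<circ> Transposition.transpose i j"
proof -
  obtain i j where ij: "i \<in> {1..n}" "j \<in> {1..n}" "i \<le> j" and w: "w = u \<circ> Transposition.transpose i j"
    and inv: "inversions n u < inversions n w" and u: "u permutes {1..n}"
    using assms unfolding bruhat_step_def by (metis linorder_le_cases transpose_commute)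
  have ne: "i \<noteq> j" using w inv by auto
  have "u i < u j"
  proof (rule ccontr)
    assume "\<not> u i < u j"
    moreover have "u i \<noteq> u j" using permutes_inj[OF u] ne by (auto simp: inj_eq)
    ultimately have "w i < w j" by (auto simp: w)
    hence "inversions n w < inversions n (w \<circ> Transposition.transpose i j)"
      using ij ne by (intro inversions_less_transpose) auto
    moreover have "w \<circ> Transposition.transpose i j = u" by (simp add: w fun_eq_iff)
    ultimately show False using inv by simp
  qed
  thus thesis using that[of i j] ij ne w by auto
qed

lemma permutes_comp_transpose:
  "u permutes S \<Longrightarrow> i \<in> S \<Longrightarrow> j \<in> S \<Longrightarrow> (u \<circ> Transposition.transpose i j) permutes S"
  by (intro permutes_compose permutes_swap_id)

text \<open>
  The rank criterion, restricted to the positions from \<open>i\<close> on, for permutations that agree before \<open>i\<close>.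
\<close>

definition rank_le :: "nat \<Rightarrow> (nat \<Rightarrow> nat) \<Rightarrow> (nat \<Rightarrow> nat) \<Rightarrow> bool" where
  "rank_le i u v \<longleftrightarrow> (\<forall>m h. card {l \<in> {i..m}. h < u l} \<le> card {l \<in> {i..m}. h < v l})"

lemma bruhat_le_rank_le:
  assumes "bruhat_le n u v"
  shows "rank_le 1 u v"
  using assms unfolding bruhat_le_def
proof (induction rule: rtranclp_induct)
  case (step w w')
  obtain i j where "i \<in> {1..n}" "j \<in> {1..n}" "i < j" "w i < w j" "w' = w \<circ> Transposition.transpose i j"
    using step.hyps(2) by (rule bruhat_stepE)
  hence "rank_le 1 w w'"
    unfolding rank_le_def using card_above_mono[of "{1.._}" w i j] by auto
  thus ?case using step.IH unfolding rank_le_def by (meson le_trans)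
qed (simp add: rank_le_def)

text \<open>
  The greedy step towards \<open>v\<close>: \<open>j\<close> is the first position after \<open>i\<close> whose entry is larger than
  \<open>u i\<close> but not beyond the target \<open>v i\<close>. Only the counts with \<open>i \<le> m < j\<close> and
  \<open>u i \<le> h < u j\<close> grow. By the choice of \<open>j\<close>, for these the entries of \<open>u\<close> above \<open>h\<close> are already
  above \<open>v i\<close>, whereas \<open>v\<close> has the additional entry \<open>v i\<close>; so the inequality was strict.
\<close>

lemma rank_le_next:
  assumes r: "rank_le i u v" and ij: "i < j" and uij: "u i < u j" "u j \<le> v i"
    and gap: "\<And>l. i < l \<Longrightarrow> l < j \<Longrightarrow> \<not> (u i < u l \<and> u l \<le> v i)"
  shows "rank_le i (u \<circ> Transposition.transpose i j) v"
  unfolding rank_le_def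
proof (intro allI)
  fix m h
  let ?w = "u \<circ> Transposition.transpose i j"
  let ?C = "\<lambda>w h. card {l \<in> {i..m}. h < w l}"
  have le: "?C u h' \<le> ?C v h'" for h' using r by (auto simp: rank_le_def)
  consider "m < i" | "j \<le> m" | "i \<le> m" "m < j" "u i \<le> h" "h < u j"
    | "i \<le> m" "m < j" "\<not> (u i \<le> h \<and> h < u j)" by linarith
  thus "?C ?w h \<le> ?C v h"
  proof cases
    case 2
    have "Transposition.transpose i j ` {l \<in> {i..m}. h < ?w l} \<subseteq> {l \<in> {i..m}. h < u l}"
      using 2 ij by (auto simp: Transposition.transpose_def)
    hence "card (Transposition.transpose i j ` {l \<in> {i..m}. h < ?w l}) \<le> ?C u h"
      by (intro card_mono) auto
    hence "?C ?w h \<le> ?C u h" by (simp add: card_image)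
    thus ?thesis using le le_trans by blast
  next
    case 3
    have "?C ?w h \<le> card (insert i {l \<in> {i..m}. v i < u l})"
    proof (rule card_mono)
      show "{l \<in> {i..m}. h < ?w l} \<subseteq> insert i {l \<in> {i..m}. v i < u l}"
      proof
        fix l assume l: "l \<in> {l \<in> {i..m}. h < ?w l}"
        show "l \<in> insert i {l \<in> {i..m}. v i < u l}"
        proof (cases "l = i")
          case False
          hence "i < l" "l < j" "h < u l" using l 3 by (auto simp: Transposition.transpose_def)
          thus ?thesis using gap[of l] 3 l by auto
        qed auto
      qed
    qed auto
    also have "\<dots> = Suc (?C u (v i))" using uij by (subst card_insert_disjoint) auto
    also have "\<dots> \<le> Suc (?C v (v i))" using le by simp
    also have "\<dots> = card (insert i {l \<in> {i..m}. v i < v l})"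
      by (subst card_insert_disjoint) auto
    also have "\<dots> \<le> ?C v h"
      using 3 uij by (intro card_mono) auto
    finally show ?thesis .
  next
    case 4
    have "{l \<in> {i..m}. h < ?w l} \<subseteq> {l \<in> {i..m}. h < u l}"
    proof
      fix l assume l: "l \<in> {l \<in> {i..m}. h < ?w l}"
      show "l \<in> {l \<in> {i..m}. h < u l}"
        using l 4 by (cases "l = i") auto
    qed
    hence "?C ?w h \<le> ?C u h" by (intro card_mono) auto
    thus ?thesis using le le_trans by blast
  qed auto
qed

lemma rank_le_Suc:
  assumes "rank_le i u v" "u i = v i"
  shows "rank_le (Suc i) u v"
  unfolding rank_le_def
proof (intro allI)
  fix m h
  show "card {l \<in> {Suc i..m}. h < u l} \<le> card {l \<in> {Suc i..m}. h < v l}"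
  proof (cases "i \<le> m")
    case True
    have "{l \<in> {i..m}. h < w l} = (if h < w i then {i} else {}) \<union> {l \<in> {Suc i..m}. h < w l}" for w :: "nat \<Rightarrow> nat"
      using True by (auto simp: le_less Suc_le_eq)
    hence "card {l \<in> {i..m}. h < w l} = (if h < w i then 1 else 0) + card {l \<in> {Suc i..m}. h < w l}"
      for w :: "nat \<Rightarrow> nat"
      by (auto simp: card_insert_if)
    moreover have "card {l \<in> {i..m}. h < u l} \<le> card {l \<in> {i..m}. h < v l}"
      using assms(1) by (auto simp: rank_le_def)
    ultimately show ?thesis using assms(2) by simp
  qed auto
qed

section \<open>The lexicographic chain is unique\<close>

abbreviation point :: "(nat \<Rightarrow> nat) \<Rightarrow> (nat \<Rightarrow> nat) \<Rightarrow> nat" where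
  "point v \<equiv> (\<lambda>w. if w = v then 1 else 0)"

lemma bruhat_ops_point_fixed:
  assumes "u i \<noteq> v i" "\<forall>(k, l)\<in>set K. k \<noteq> i \<and> l \<noteq> i"
  shows "bruhat_ops K (point v) u = 0"
  using assms
proof (induction K arbitrary: u)
  case (Cons t K)
  obtain k l where "t = (k, l)" by (cases t)
  thus ?case using Cons by (auto simp: bruhat_op_def)
qed auto

text \<open>
  The steps \<open>(i, y)\<close> only raise the entry at \<open>i\<close>, so a chain that has overshot cannot reach \<open>v\<close>.
\<close>

lemma bruhat_ops_point_above:
  assumes "v i < u i" "\<forall>(k, l)\<in>set K. k \<noteq> i \<and> l \<noteq> i"
  shows "bruhat_ops (map (Pair i) ys @ K) (point v) u = 0"
  using assms
proof (induction ys arbitrary: u)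
  case Nil
  thus ?case by (simp add: bruhat_ops_point_fixed[of u i])
next
  case (Cons y ys)
  have "bruhat_ops (map (Pair i) ys @ K) (point v) (u \<circ> Transposition.transpose i y) = 0" if "covers i y u"
    using that Cons.prems by (intro Cons.IH) (auto simp: covers_def)
  thus ?case using Cons by (simp add: bruhat_op_def)
qed

text \<open>
  A useful entry at a position \<open>l\<close> that has been passed cannot be made up for: raising the entry at
  \<open>i\<close> beyond it later would not be a covering step, because position \<open>l\<close> lies in between.
\<close>

lemma bruhat_ops_point_missed:
  assumes "i < l" "\<forall>y\<in>set ys. l < y" "u i < u l" "u l \<le> v i" "\<forall>(k, l)\<in>set K. k \<noteq> i \<and> l \<noteq> i"
  shows "bruhat_ops (map (Pair i) ys @ K) (point v) u = 0"
  using assms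
proof (induction ys arbitrary: u)
  case Nil
  thus ?case by (simp add: bruhat_ops_point_fixed[of u i])
next
  case (Cons y ys)
  have "bruhat_ops (map (Pair i) ys @ K) (point v) (u \<circ> Transposition.transpose i y) = 0" if c: "covers i y u"
  proof (rule Cons.IH)
    have "u y \<le> u l" "u y \<noteq> u l" using c Cons.prems by (auto simp: covers_def inj_eq)
    moreover have "(u \<circ> Transposition.transpose i y) l = u l" "(u \<circ> Transposition.transpose i y) i = u y"
      using Cons.prems by (auto simp: Transposition.transpose_def)
    ultimately show "(u \<circ> Transposition.transpose i y) i < (u \<circ> Transposition.transpose i y) l"
      "(u \<circ> Transposition.transpose i y) l \<le> v i"
      using Cons.prems by auto
  qed (use Cons.prems in auto)
  thus ?case using Cons by (simp add: bruhat_op_def)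
qed

text \<open>
  At each pair \<open>(i, j)\<close> the choice is forced. If \<open>u j\<close> lies above \<open>u i\<close> and not beyond \<open>v i\<close>, then
  omitting the step is fatal by \<open>bruhat_ops_point_missed\<close>, and taking it preserves the rank criterion by
  \<open>rank_le_next\<close>. Otherwise a step would overshoot. When all pairs with first component \<open>i\<close> are
  used up, the entry at \<open>i\<close> is the right one and the next position is treated.
\<close>

lemma bruhat_ops_lex_pairs_from:
  assumes "v permutes {1..n}" "1 \<le> i" "i \<le> Suc n"
    and "u permutes {1..n}" "\<forall>l<i. u l = v l" "rank_le i u v"
  shows "bruhat_ops (lex_pairs [i..<Suc n]) (point v) u = 1"
  using assms(3,2,4-)
proof (induction i arbitrary: u rule: inc_induct)
  case base
  have "u = v"
  proof
    fix l show "u l = v l"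
      using base assms(1) by (cases "l \<le> n") (auto simp: permutes_def)
  qed
  thus ?case by simp
next
  case (step i)
  define K where "K = lex_pairs [Suc i..<Suc n]"
  have K: "\<forall>(k, l)\<in>set K. k \<noteq> i \<and> l \<noteq> i"
    by (auto simp: K_def dest!: set_lex_pairs)
  have i: "1 \<le> i" by (fact step.prems)
  \<comment> \<open>The last assumption is the invariant that no useful entry has been passed.\<close>
  have inner: "bruhat_ops (map (Pair i) [j..<Suc n] @ K) (point v) u = 1"
    if "j \<le> Suc n" "i < j" "u permutes {1..n}" "\<forall>l<i. u l = v l" "rank_le i u v"
      "\<forall>l. i < l \<and> l < j \<longrightarrow> \<not> (u i < u l \<and> u l \<le> v i)" for j u
    using that
  proof (induction j arbitrary: u rule: inc_induct)
    case base
    have "u i \<le> v i"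
    proof (rule ccontr)
      assume "\<not> u i \<le> v i"
      hence "{l \<in> {i..i}. v i < u l} = {i}" "{l \<in> {i..i}. v i < v l} = {}" by auto
      moreover have "card {l \<in> {i..i}. v i < u l} \<le> card {l \<in> {i..i}. v i < v l}"
        using \<open>rank_le i u v\<close> unfolding rank_le_def by blast
      ultimately have "card {i} \<le> card ({} :: nat set)" by (simp only:)
      thus False by simp
    qed
    moreover have "\<not> u i < v i"
    proof
      assume less: "u i < v i"
      have "i \<in> {1..n}" using i step.hyps by auto
      hence "v i \<in> {1..n}" by (simp only: permutes_in_image[OF assms(1)])
      hence "v i \<in> u ` {1..n}" by (simp only: permutes_image[OF \<open>u permutes {1..n}\<close>])
      then obtain l where l: "l \<in> {1..n}" "u l = v i" by auto
      have "l \<noteq> i" using l less by auto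
      moreover have "\<not> l < i"
      proof
        assume "l < i"
        hence "v l = v i" using \<open>\<forall>l<i. u l = v l\<close> l by simp
        thus False using \<open>l < i\<close> permutes_inj[OF assms(1)] by (simp add: inj_eq)
      qed
      ultimately have "i < l" "l < Suc n" using l by auto
      hence "\<not> (u i < u l \<and> u l \<le> v i)"
        using \<open>\<forall>l. i < l \<and> l < Suc n \<longrightarrow> \<not> (u i < u l \<and> u l \<le> v i)\<close> by blast
      thus False using l less by simp
    qed
    ultimately have eq: "u i = v i" by simp
    have "\<forall>l<Suc i. u l = v l"
      using eq \<open>\<forall>l<i. u l = v l\<close> less_Suc_eq by metis
    hence "bruhat_ops K (point v) u = 1" unfolding K_def
      using rank_le_Suc[OF \<open>rank_le i u v\<close> eq] \<open>u permutes {1..n}\<close> by (intro step.IH) auto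
    thus ?case by simp
  next
    case (step j)
    note perm = \<open>u permutes {1..n}\<close> and agree = \<open>\<forall>l<i. u l = v l\<close> and rank = \<open>rank_le i u v\<close>
      and gap = \<open>\<forall>l. i < l \<and> l < j \<longrightarrow> \<not> (u i < u l \<and> u l \<le> v i)\<close>
      and ij = \<open>i < j\<close> and jn = \<open>j < Suc n\<close> and IH = step.IH
    let ?w = "u \<circ> Transposition.transpose i j" and ?L = "map (Pair i) [Suc j..<Suc n] @ K"
    have list: "map (Pair i) [j..<Suc n] @ K = (i, j) # ?L"
      using jn by (simp add: upt_conv_Cons del: upt_Suc)
    have w: "?w i = u j" "?w j = u i" "\<And>l. l \<noteq> i \<Longrightarrow> l \<noteq> j \<Longrightarrow> ?w l = u l"
      by simp_all
    show ?case
    proof (cases "u i < u j \<and> u j \<le> v i")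
      case True
      have "covers i j u"
        unfolding covers_def using True gap ij permutes_inj[OF perm] by force
      moreover have "bruhat_ops ?L (point v) u = 0"
        using True ij K by (intro bruhat_ops_point_missed[where l = j]) auto
      moreover have "bruhat_ops ?L (point v) ?w = 1"
      proof (rule IH)
        show "?w permutes {1..n}" using perm ij jn i by (intro permutes_comp_transpose) auto
        show "rank_le i ?w v" using True gap by (intro rank_le_next[OF rank ij]) blast+
        show "\<forall>l. i < l \<and> l < Suc j \<longrightarrow> \<not> (?w i < ?w l \<and> ?w l \<le> v i)"
        proof (intro allI impI)
          fix l assume l: "i < l \<and> l < Suc j"
          show "\<not> (?w i < ?w l \<and> ?w l \<le> v i)"
          proof (cases "l = j")
            case False
            hence "\<not> (u i < u l \<and> u l \<le> v i)" using l gap by auto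
            thus ?thesis using w False l True by simp
          qed (use w True in simp)
        qed
        show "\<forall>l<i. ?w l = v l" using agree w ij by simp
        show "i < Suc j" using ij by simp
      qed
      ultimately show ?thesis unfolding list by (simp add: bruhat_op_def)
    next
      case False
      have "\<forall>l. i < l \<and> l < Suc j \<longrightarrow> \<not> (u i < u l \<and> u l \<le> v i)"
        using False gap less_Suc_eq by metis
      hence "bruhat_ops ?L (point v) u = 1"
        using ij perm agree rank by (intro IH) auto
      moreover have "bruhat_ops ?L (point v) ?w = 0" if "covers i j u"
        using that False K w by (intro bruhat_ops_point_above) (auto simp: covers_def)
      ultimately show ?thesis unfolding list by (simp add: bruhat_op_def)
    qed
  qed
  have "lex_pairs [i..<Suc n] = map (Pair i) [Suc i..<Suc n] @ K"
    using step.hyps by (simp add: K_def upt_conv_Cons del: upt_Suc)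
  thus ?case using inner[of "Suc i" u] step.prems step.hyps by auto
qed

lemma bruhat_ops_lex_pairs:
  assumes "u permutes {1..n}" "v permutes {1..n}" "bruhat_le n u v"
  shows "bruhat_ops (lex_pairs [1..<Suc n]) (point v) u = 1"
proof (rule bruhat_ops_lex_pairs_from)
  have "u 0 = 0" "v 0 = 0" using assms by (auto simp: permutes_def)
  thus "\<forall>l<1. u l = v l" by simp
qed (use assms bruhat_le_rank_le in auto)

section \<open>Chains with ascending steps followed by descending steps\<close>

text \<open>
  The chains counted by a product of Bruhat operators: each pair of the list is used as a covering
  step or omitted.
\<close>

fun bruhat_path :: "(nat \<times> nat) list \<Rightarrow> (nat \<Rightarrow> nat) \<Rightarrow> (nat \<Rightarrow> nat) \<Rightarrow> bool" where
  "bruhat_path [] u z \<longleftrightarrow> u = z"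
| "bruhat_path ((i, j) # L) u z \<longleftrightarrow>
     bruhat_path L u z \<or> covers i j u \<and> bruhat_path L (u \<circ> Transposition.transpose i j) z"

lemma bruhat_path_if_ops_pos: "bruhat_ops L f u > 0 \<Longrightarrow> \<exists>z. bruhat_path L u z \<and> f z > 0"
proof (induction L arbitrary: u)
  case (Cons t L)
  obtain i j where t: "t = (i, j)" by (cases t)
  let ?w = "u \<circ> Transposition.transpose i j"
  have "bruhat_ops L f u > 0 \<or> covers i j u \<and> bruhat_ops L f ?w > 0"
    using Cons.prems by (auto simp: t bruhat_op_def split: if_splits)
  thus ?case unfolding t using Cons.IH[of u] Cons.IH[of ?w] by fastforce
qed auto

lemma bruhat_ops_ge: "bruhat_path L u z \<Longrightarrow> f z \<le> bruhat_ops L f u"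
proof (induction L arbitrary: u)
  case (Cons t L)
  obtain i j where t: "t = (i, j)" by (cases t)
  define w where "w = u \<circ> Transposition.transpose i j"
  have eq: "bruhat_ops (t # L) f u = bruhat_ops L f u + (if covers i j u then bruhat_ops L f w else 0)"
    by (simp add: t bruhat_op_def w_def)
  consider "bruhat_path L u z" | "covers i j u" "bruhat_path L w z"
    using Cons.prems unfolding t w_def by auto
  thus ?case
  proof cases
    case 1
    show ?thesis unfolding eq by (rule trans_le_add1) (rule Cons.IH[OF 1])
  next
    case 2
    show ?thesis unfolding eq using Cons.IH[OF 2(2)] 2(1) by simp
  qed
qed auto

text \<open>
  This turns a count of one into uniqueness of the end point.
\<close>

lemma bruhat_ops_ge_two:
  assumes "bruhat_path L u z" "bruhat_path L u z'" "z \<noteq> z'"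
  shows "f z + f z' \<le> bruhat_ops L f u"
  using assms
proof (induction L arbitrary: u)
  case (Cons t L)
  obtain i j where t: "t = (i, j)" by (cases t)
  let ?w = "u \<circ> Transposition.transpose i j"
  have eq: "bruhat_ops (t # L) f u = bruhat_ops L f u + (if covers i j u then bruhat_ops L f ?w else 0)"
    by (simp add: t bruhat_op_def)
  consider "bruhat_path L u z" "bruhat_path L u z'"
    | "covers i j u" "bruhat_path L ?w z" "bruhat_path L ?w z'"
    | "covers i j u" "bruhat_path L u z" "bruhat_path L ?w z'"
    | "covers i j u" "bruhat_path L ?w z" "bruhat_path L u z'"
    using Cons.prems(1,2) unfolding t by auto
  thus ?case
  proof cases
    case 1
    show ?thesis unfolding eq by (rule trans_le_add1) (rule Cons.IH[OF 1 Cons.prems(3)])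
  next
    case 2
    thus ?thesis unfolding eq using Cons.IH[OF 2(2,3) Cons.prems(3)] by (simp only: if_True trans_le_add2)
  next
    case 3
    show ?thesis unfolding eq using bruhat_ops_ge[OF 3(2), of f] bruhat_ops_ge[OF 3(3), of f] 3(1)
      by (simp only: if_True add_mono)
  next
    case 4
    show ?thesis unfolding eq using bruhat_ops_ge[OF 4(2), of f] bruhat_ops_ge[OF 4(3), of f] 4(1)
      by (simp only: if_True add.commute[of "f z"] add_mono)
  qed
qed auto

lemma bruhat_le_refl: "bruhat_le n u u"
  by (simp add: bruhat_le_def)

lemma bruhat_le_trans: "bruhat_le n u v \<Longrightarrow> bruhat_le n v w \<Longrightarrow> bruhat_le n u w"
  unfolding bruhat_le_def by (rule rtranclp_trans)

lemma covers_bruhat_le: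
  assumes "u permutes {1..n}" "i \<in> {1..n}" "j \<in> {1..n}" "covers i j u"
  shows "bruhat_le n u (u \<circ> Transposition.transpose i j)"
  using assms unfolding bruhat_le_def covers_def by (intro r_into_rtranclp bruhat_step_transpose) auto

lemma bruhat_path_ConsE:
  assumes "bruhat_path (t # L) u z" "u permutes {1..n}" "set (t # L) \<subseteq> {1..n} \<times> {1..n}"
  obtains (skip) "bruhat_path L u z"
  | (step) i j w where "t = (i, j)" "w = u \<circ> Transposition.transpose i j" "u i < u j"
      "w permutes {1..n}" "bruhat_le n u w" "bruhat_path L w z"
proof -
  obtain i j where t: "t = (i, j)" by (cases t)
  hence ij: "i \<in> {1..n}" "j \<in> {1..n}" using assms(3) by auto
  consider "bruhat_path L u z"
    | "covers i j u" "bruhat_path L (u \<circ> Transposition.transpose i j) z"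
    using assms(1) unfolding t by auto
  thus thesis
  proof cases
    case 2
    have "u i < u j" using 2(1) by (simp add: covers_def)
    thus thesis
      by (rule step[OF t refl _ permutes_comp_transpose[OF assms(2) ij]
            covers_bruhat_le[OF assms(2) ij 2(1)] 2(2)])
  qed (rule skip)
qed

lemma bruhat_path_le:
  assumes "bruhat_path L u z" "u permutes {1..n}" "set L \<subseteq> {1..n} \<times> {1..n}"
  shows "bruhat_le n u z \<and> z permutes {1..n}"
  using assms
proof (induction L arbitrary: u)
  case (Cons t L)
  from Cons.prems show ?case
  proof (cases rule: bruhat_path_ConsE)
    case (step i j w)
    have "bruhat_le n w z \<and> z permutes {1..n}"
      by (rule Cons.IH[OF step(6,4)]) (use Cons.prems(3) in simp)
    thus ?thesis using bruhat_le_trans step(5) by blast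
  qed (use Cons in simp)
qed (simp add: bruhat_le_refl)

lemma bruhat_path_first_step:
  assumes "bruhat_path L u z" "u \<noteq> z" "u permutes {1..n}" "set L \<subseteq> {1..n} \<times> {1..n}"
  shows "\<exists>i j. (i, j) \<in> set L \<and> u i < u j \<and> bruhat_le n u (u \<circ> Transposition.transpose i j) \<and>
    bruhat_le n (u \<circ> Transposition.transpose i j) z"
  using assms
proof (induction L arbitrary: u)
  case (Cons t L)
  have L: "set L \<subseteq> {1..n} \<times> {1..n}" using Cons.prems(4) by simp
  from Cons.prems(1,3,4) show ?case
  proof (cases rule: bruhat_path_ConsE)
    case skip
    obtain i j where ij: "(i, j) \<in> set L" "u i < u j"
      "bruhat_le n u (u \<circ> Transposition.transpose i j)" "bruhat_le n (u \<circ> Transposition.transpose i j) z"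
      using Cons.IH[OF skip Cons.prems(2,3) L] by (elim exE conjE)
    have "(i, j) \<in> set (t # L)" using ij(1) by simp
    thus ?thesis using ij(2-) by (intro exI conjI)
  next
    case (step i j w)
    have "bruhat_le n w z" using bruhat_path_le[OF step(6,4) L] by blast
    moreover have "(i, j) \<in> set (t # L)" using step(1) by simp
    ultimately show ?thesis using step(3,5) unfolding step(2) by (intro exI conjI)
  qed
qed simp

lemma bruhat_path_last_step:
  assumes "bruhat_path L u z" "u \<noteq> z" "u permutes {1..n}" "set L \<subseteq> {1..n} \<times> {1..n}"
  shows "\<exists>i j. (i, j) \<in> set L \<and> z j < z i \<and> bruhat_le n u (z \<circ> Transposition.transpose i j) \<and>
    bruhat_le n (z \<circ> Transposition.transpose i j) z"
  using assms
proof (induction L arbitrary: u)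
  case (Cons t L)
  have L: "set L \<subseteq> {1..n} \<times> {1..n}" using Cons.prems(4) by simp
  from Cons.prems(1,3,4) show ?case
  proof (cases rule: bruhat_path_ConsE)
    case skip
    obtain i j where ij: "(i, j) \<in> set L" "z j < z i"
      "bruhat_le n u (z \<circ> Transposition.transpose i j)" "bruhat_le n (z \<circ> Transposition.transpose i j) z"
      using Cons.IH[OF skip Cons.prems(2,3) L] by (elim exE conjE)
    have "(i, j) \<in> set (t # L)" using ij(1) by simp
    thus ?thesis using ij(2-) by (intro exI conjI)
  next
    case (step i j w)
    show ?thesis
    proof (cases "w = z")
      case True
      have "z \<circ> Transposition.transpose i j = u"
        unfolding True[symmetric] step(2) by (simp add: fun_eq_iff)
      moreover have "z j < z i" unfolding True[symmetric] step(2) using step(3) by simp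
      moreover have "(i, j) \<in> set (t # L)" using step(1) by simp
      moreover have "bruhat_le n u z" using step(5) by (simp only: True)
      ultimately have "(i, j) \<in> set (t # L) \<and> z j < z i \<and> bruhat_le n u (z \<circ> Transposition.transpose i j) \<and>
          bruhat_le n (z \<circ> Transposition.transpose i j) z"
        using bruhat_le_refl[of n u] by (simp only:)
      thus ?thesis by (intro exI)
    next
      case False
      obtain k l where kl: "(k, l) \<in> set L" "z l < z k" "bruhat_le n w (z \<circ> Transposition.transpose k l)"
        "bruhat_le n (z \<circ> Transposition.transpose k l) z"
        using Cons.IH[OF step(6) False step(4) L] by (elim exE conjE)
      have "(k, l) \<in> set (t # L)" using kl(1) by simp
      thus ?thesis using kl(2,4) bruhat_le_trans[OF step(5) kl(3)] by (intro exI conjI)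
    qed
  qed
qed simp

fun before :: "'a list \<Rightarrow> 'a \<Rightarrow> 'a \<Rightarrow> bool" where
  "before [] p q \<longleftrightarrow> False"
| "before (a # as) p q \<longleftrightarrow> p = a \<and> q \<in> set as \<or> before as p q"

lemma before_in_set: "before as p q \<Longrightarrow> p \<in> set as \<and> q \<in> set as"
  by (induction as) auto

lemma before_take:
  "before as p q \<Longrightarrow> distinct as \<Longrightarrow> q \<in> set (take m as) \<Longrightarrow> p \<in> set (take m as)"
proof (induction as arbitrary: m)
  case (Cons a as)
  thus ?case using before_in_set[of as p q] by (cases m) auto
qed auto

lemma before_separated:
  "before as p q \<Longrightarrow> distinct as \<Longrightarrow> \<exists>m \<le> length as. p \<in> set (take m as) \<and> q \<notin> set (take m as)"
proof (induction as)
  case (Cons a as)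
  show ?case
  proof (cases "p = a \<and> q \<in> set as")
    case True
    thus ?thesis using Cons.prems by (intro exI[of _ 1]) auto
  next
    case False
    then obtain m where "m \<le> length as" "p \<in> set (take m as)" "q \<notin> set (take m as)" "before as p q"
      using Cons by auto
    thus ?thesis using Cons.prems before_in_set[of as p q] by (intro exI[of _ "Suc m"]) auto
  qed
qed auto

lemma ascending_pairs_before: "(i, j) \<in> set (ascending_pairs as) \<Longrightarrow> before as i j"
  by (induction as) auto

lemma descending_pairs_before: "(i, j) \<in> set (descending_pairs as) \<Longrightarrow> before as j i"
  by (induction as) auto

section \<open>Local maxima of a Bruhat interval\<close>

definition locally_maximal :: "nat list \<Rightarrow> (nat \<Rightarrow> nat) set \<Rightarrow> (nat \<Rightarrow> nat) \<Rightarrow> bool" where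
  "locally_maximal as W z \<longleftrightarrow> z \<in> W \<and>
     (\<forall>p q. before as p q \<and> z p < z q \<longrightarrow> z \<circ> Transposition.transpose p q \<notin> W)"

text \<open>
  Any \<open>u \<le> v\<close> determine exactly one turning point \<open>z\<close>: the lexicographic product counts one chain
  from \<open>u\<close> to \<open>v\<close>, and this product equals the ascending product followed by the descending one.
\<close>

lemma bruhat_factorization:
  assumes "distinct as" "set as = {1..n}" "u permutes {1..n}" "v permutes {1..n}" "bruhat_le n u v"
  shows "\<exists>z. bruhat_path (ascending_pairs as) u z \<and> bruhat_path (descending_pairs as) z v"
    and "bruhat_path (ascending_pairs as) u z \<Longrightarrow> bruhat_path (descending_pairs as) z v \<Longrightarrow>
      bruhat_path (ascending_pairs as) u z' \<Longrightarrow> bruhat_path (descending_pairs as) z' v \<Longrightarrow> z = z'"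
proof -
  let ?A = "ascending_pairs as" and ?D = "descending_pairs as"
  have "sort as = sorted_list_of_set (set as)"
    using assms(1) by (simp only: sorted_list_of_set_sort_remdups distinct_remdups_id)
  also have "\<dots> = [1..<Suc n]"
    by (simp only: assms(2) atLeastLessThanSuc_atLeastAtMost[symmetric] sorted_list_of_set_range)
  finally have "sort as = [1..<Suc n]" .
  hence one: "bruhat_ops ?A (bruhat_ops ?D (point v)) u = 1"
    using bruhat_ops_lex_pairs[OF assms(3-5)] lex_pairs_factor[OF assms(1)] by simp
  then obtain w where w: "bruhat_path ?A u w" "bruhat_ops ?D (point v) w > 0"
    using bruhat_path_if_ops_pos[of ?A "bruhat_ops ?D (point v)" u] by auto
  moreover have "bruhat_path ?D w v"
    using bruhat_path_if_ops_pos[OF w(2)] by (auto split: if_splits)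
  ultimately show "\<exists>z. bruhat_path ?A u z \<and> bruhat_path ?D z v" by blast
  assume paths: "bruhat_path ?A u z" "bruhat_path ?D z v" "bruhat_path ?A u z'" "bruhat_path ?D z' v"
  show "z = z'"
  proof (rule ccontr)
    assume "z \<noteq> z'"
    hence "bruhat_ops ?D (point v) z + bruhat_ops ?D (point v) z' \<le> 1"
      using bruhat_ops_ge_two[OF paths(1,3), of "bruhat_ops ?D (point v)"] one by simp
    moreover have "bruhat_ops ?D (point v) z \<ge> 1" "bruhat_ops ?D (point v) z' \<ge> 1"
      using bruhat_ops_ge[OF paths(2), of "point v"] bruhat_ops_ge[OF paths(4), of "point v"] by auto
    ultimately show False by linarith
  qed
qed

lemma ascending_descending_pairs_subset:
  assumes "set as = {1..n}"
  shows "set (ascending_pairs as) \<subseteq> {1..n} \<times> {1..n}" "set (descending_pairs as) \<subseteq> {1..n} \<times> {1..n}"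
  using ascending_pairs_before[of _ _ as] descending_pairs_before[of _ _ as] before_in_set[of as] assms
  by fastforce+

text \<open>
  If the chain from \<open>u\<close> to \<open>z\<close> had descending steps, then undoing the last one would be an improving
  exchange that stays between \<open>u\<close> and \<open>z\<close>. Likewise the first ascending step of the chain from
  \<open>z\<close> to \<open>v\<close> would be an improving exchange.
\<close>

lemma locally_maximal_paths:
  assumes as: "distinct as" "set as = {1..n}" and u: "u permutes {1..n}" and v: "v permutes {1..n}"
    and max: "locally_maximal as (bruhat_interval n u v) z"
  shows "bruhat_path (ascending_pairs as) u z" "bruhat_path (descending_pairs as) z v"
proof -
  let ?A = "ascending_pairs as" and ?D = "descending_pairs as"
  have z: "z permutes {1..n}" "bruhat_le n u z" "bruhat_le n z v"
    using max by (auto simp: locally_maximal_def bruhat_interval_def)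
  have max': False if "before as p q" "z p < z q" "bruhat_le n u (z \<circ> Transposition.transpose p q)"
    "bruhat_le n (z \<circ> Transposition.transpose p q) v" for p q
  proof -
    have "(z \<circ> Transposition.transpose p q) permutes {1..n}"
      using z(1) before_in_set[OF that(1)] as by (intro permutes_comp_transpose) auto
    thus False using that max by (auto simp: locally_maximal_def bruhat_interval_def)
  qed
  show "bruhat_path ?A u z"
  proof -
    obtain w where w: "bruhat_path ?A u w" "bruhat_path ?D w z"
      using bruhat_factorization(1)[OF as u z(1,2)] by blast
    have wp: "w permutes {1..n}" using bruhat_path_le[OF w(1) u ascending_descending_pairs_subset(1)[OF as(2)]] by blast
    have "w = z"
    proof (rule ccontr)
      assume "w \<noteq> z"
      then obtain i j where ij: "(i, j) \<in> set ?D" "z j < z i"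
        "bruhat_le n w (z \<circ> Transposition.transpose i j)" "bruhat_le n (z \<circ> Transposition.transpose i j) z"
        using bruhat_path_last_step[OF w(2) _ wp ascending_descending_pairs_subset(2)[OF as(2)]] by blast
      have "bruhat_le n u w" using bruhat_path_le[OF w(1) u ascending_descending_pairs_subset(1)[OF as(2)]] by blast
      thus False
        using max'[OF descending_pairs_before[OF ij(1)] ij(2)] bruhat_le_trans[OF _ ij(3), of u]
          bruhat_le_trans[OF ij(4) z(3)] by (simp add: transpose_commute[of j i])
    qed
    thus ?thesis using w by simp
  qed
  show "bruhat_path ?D z v"
  proof -
    obtain w where w: "bruhat_path ?A z w" "bruhat_path ?D w v"
      using bruhat_factorization(1)[OF as z(1) v z(3)] by blast
    have wp: "w permutes {1..n}" using bruhat_path_le[OF w(1) z(1) ascending_descending_pairs_subset(1)[OF as(2)]] by blast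
    have "z = w"
    proof (rule ccontr)
      assume "z \<noteq> w"
      then obtain i j where ij: "(i, j) \<in> set ?A" "z i < z j"
        "bruhat_le n z (z \<circ> Transposition.transpose i j)" "bruhat_le n (z \<circ> Transposition.transpose i j) w"
        using bruhat_path_first_step[OF w(1) _ z(1) ascending_descending_pairs_subset(1)[OF as(2)]] by blast
      have "bruhat_le n w v" using bruhat_path_le[OF w(2) wp ascending_descending_pairs_subset(2)[OF as(2)]] by blast
      thus False
        using max'[OF ascending_pairs_before[OF ij(1)] ij(2)] bruhat_le_trans[OF z(2) ij(3)]
          bruhat_le_trans[OF ij(4), of v] by simp
    qed
    thus ?thesis using w by simp
  qed
qed

lemma locally_maximal_unique:
  assumes "distinct as" "set as = {1..n}" "u permutes {1..n}" "v permutes {1..n}"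
    and "locally_maximal as (bruhat_interval n u v) z" "locally_maximal as (bruhat_interval n u v) z'"
  shows "z = z'"
proof (rule bruhat_factorization(2)[OF assms(1-4)])
  show "bruhat_le n u v"
    using assms(5) bruhat_le_trans by (auto simp: locally_maximal_def bruhat_interval_def)
qed (use locally_maximal_paths[OF assms(1-4)] assms(5,6) in blast)+

lemma sum_transpose_mono:
  fixes z :: "nat \<Rightarrow> nat"
  assumes "finite A" "z p < z q" "q \<in> A \<longrightarrow> p \<in> A"
  shows "sum z A \<le> sum (z \<circ> Transposition.transpose p q) A"
    and "p \<in> A \<Longrightarrow> q \<notin> A \<Longrightarrow> sum z A < sum (z \<circ> Transposition.transpose p q) A"
proof -
  show less: "sum z A < sum (z \<circ> Transposition.transpose p q) A" if "p \<in> A" "q \<notin> A"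
  proof -
    let ?w = "z \<circ> Transposition.transpose p q"
    have "sum z (A - {p}) = sum ?w (A - {p})"
    proof (rule sum.cong[OF refl])
      fix x assume "x \<in> A - {p}"
      hence "x \<noteq> p" "x \<noteq> q" using that by auto
      thus "z x = ?w x" by simp
    qed
    moreover have "sum z A = z p + sum z (A - {p})" "sum ?w A = ?w p + sum ?w (A - {p})"
      using that assms(1) sum.remove[of A p z] sum.remove[of A p ?w] by simp_all
    moreover have "?w p = z q" by simp
    ultimately show ?thesis using assms(2) by linarith
  qed
  show "sum z A \<le> sum (z \<circ> Transposition.transpose p q) A"
  proof (cases "p \<in> A \<and> q \<notin> A")
    case False
    hence img: "Transposition.transpose p q ` A = A"
      using assms(3) by (intro transpose_image_eq) auto
    have "sum (z \<circ> Transposition.transpose p q) A = sum z (Transposition.transpose p q ` A)"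
      by (subst sum.reindex) auto
    thus ?thesis unfolding img by simp
  qed (use less in auto)
qed

definition prefix_dominates :: "nat list \<Rightarrow> (nat \<Rightarrow> nat) \<Rightarrow> (nat \<Rightarrow> nat) \<Rightarrow> bool" where
  "prefix_dominates as z y \<longleftrightarrow>
     (\<forall>m h. card {p \<in> set (take m as). h < y p} \<le> card {p \<in> set (take m as). h < z p})"

text \<open>
  Improving exchanges preserve domination of \<open>y\<close> and increase the potential \<open>\<Phi>\<close>, the sum of all
  prefix sums. So a dominating element of maximal potential is a local maximum.
\<close>

lemma prefix_dominates_locally_maximal:
  assumes as: "distinct as" and W: "finite W" "y \<in> W"
  shows "\<exists>z. locally_maximal as W z \<and> prefix_dominates as z y"
proof -
  define \<Phi> where "\<Phi> z = (\<Sum>m\<le>length as. sum z (set (take m as)))" for z :: "nat \<Rightarrow> nat"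
  define C where "C = {z \<in> W. prefix_dominates as z y}"
  have "finite C" "y \<in> C" using W by (auto simp: C_def prefix_dominates_def)
  hence "Max (\<Phi> ` C) \<in> \<Phi> ` C" by (intro Max_in) auto
  then obtain z where "z \<in> C" "\<Phi> z = Max (\<Phi> ` C)" by auto
  hence z: "z \<in> C" "\<And>z'. z' \<in> C \<Longrightarrow> \<Phi> z' \<le> \<Phi> z"
    using \<open>finite C\<close> by auto
  have "z \<circ> Transposition.transpose p q \<notin> W" if pq: "before as p q" "z p < z q" for p q
  proof
    let ?w = "z \<circ> Transposition.transpose p q"
    assume w: "?w \<in> W"
    have prefix: "q \<in> set (take m as) \<longrightarrow> p \<in> set (take m as)" for m
      using before_take[OF pq(1) as] by blast
    have "prefix_dominates as ?w y"
      unfolding prefix_dominates_def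
    proof (intro allI)
      fix m h
      have "card {p \<in> set (take m as). h < y p} \<le> card {p \<in> set (take m as). h < z p}"
        using z(1) by (auto simp: C_def prefix_dominates_def)
      also have "\<dots> \<le> card {p \<in> set (take m as). h < ?w p}"
        using prefix pq(2) by (intro card_above_mono) auto
      finally show "card {p \<in> set (take m as). h < y p} \<le> card {p \<in> set (take m as). h < ?w p}" .
    qed
    hence "\<Phi> ?w \<le> \<Phi> z" using z(2) w by (auto simp: C_def)
    moreover have "\<Phi> z < \<Phi> ?w"
      unfolding \<Phi>_def
    proof (rule sum_strict_mono_ex1)
      show "\<forall>m\<in>{..length as}. sum z (set (take m as)) \<le> sum ?w (set (take m as))"
        using sum_transpose_mono(1)[OF _ pq(2) prefix] by auto
      show "\<exists>m\<in>{..length as}. sum z (set (take m as)) < sum ?w (set (take m as))"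
        using before_separated[OF pq(1) as] sum_transpose_mono(2)[OF _ pq(2) prefix] by fastforce
    qed auto
    ultimately show False by simp
  qed
  thus ?thesis using z(1) by (auto simp: locally_maximal_def C_def)
qed

text \<open>
  Every element of the interval is dominated by a local maximum, and there is only one.
\<close>

theorem bruhat_interval_prefix_maximum:
  assumes as: "distinct as" "set as = {1..n}" and "u permutes {1..n}" "v permutes {1..n}" "bruhat_le n u v"
  shows "\<exists>z\<in>bruhat_interval n u v. \<forall>y\<in>bruhat_interval n u v. prefix_dominates as z y"
proof -
  let ?W = "bruhat_interval n u v"
  have fin: "finite ?W"
    by (rule finite_subset[OF _ finite_permutations[of "{1..n}"]]) (auto simp: bruhat_interval_def)
  have "u \<in> ?W" using assms by (simp add: bruhat_interval_def bruhat_le_refl)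
  then obtain z where z: "locally_maximal as ?W z"
    using prefix_dominates_locally_maximal[OF as(1) fin] by blast
  have "prefix_dominates as z y" if "y \<in> ?W" for y
    using prefix_dominates_locally_maximal[OF as(1) fin that] locally_maximal_unique[OF assms(1-4) z] by blast
  thus ?thesis using z by (auto simp: locally_maximal_def)
qed

section \<open>From prefix maxima to matroids and polytopes\<close>

text \<open>
  The greedy characterization of matroids: for each ordering of the ground set some basis meets every
  prefix in the largest possible number of elements. The ordering that starts with
  \<open>I - {i}\<close> and continues with \<open>J - I\<close> produces the exchange. The first block is contained in the maximal
  basis, as it is contained in \<open>I\<close>; the union of the first two blocks contains it, as it contains \<open>J\<close>.
\<close>

lemma is_matroid_if_prefix_maximum:
  assumes fin: "finite E" and ne: "\<B> \<noteq> {}" and bases: "\<And>I. I \<in> \<B> \<Longrightarrow> I \<subseteq> E \<and> card I = k"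
    and greedy: "\<And>as. distinct as \<Longrightarrow> set as = E \<Longrightarrow>
      \<exists>K\<in>\<B>. \<forall>J\<in>\<B>. \<forall>m. card (set (take m as) \<inter> J) \<le> card (set (take m as) \<inter> K)"
  shows "is_matroid E k \<B>"
  unfolding is_matroid_def
proof (intro conjI ballI impI ne)
  fix I J i assume I: "I \<in> \<B>" and J: "J \<in> \<B>" and i: "i \<in> I - J"
  note finI = finite_subset[OF conjunct1[OF bases[OF I]] fin]
    and finJ = finite_subset[OF conjunct1[OF bases[OF J]] fin]
  obtain xs where xs: "set xs = I - {i}" "distinct xs"
    using finite_distinct_list[of "I - {i}"] finI by auto
  obtain ys where ys: "set ys = J - I" "distinct ys"
    using finite_distinct_list[of "J - I"] finJ by auto
  obtain zs where zs: "set zs = E - (I - {i}) - (J - I)" "distinct zs"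
    using finite_distinct_list[of "E - (I - {i}) - (J - I)"] fin by auto
  have "distinct (xs @ ys @ zs)" "set (xs @ ys @ zs) = E"
    using xs ys zs bases[OF I] bases[OF J] by auto
  then obtain K where K: "K \<in> \<B>" and
    max: "\<And>J m. J \<in> \<B> \<Longrightarrow> card (set (take m (xs @ ys @ zs)) \<inter> J) \<le> card (set (take m (xs @ ys @ zs)) \<inter> K)"
    using greedy[of "xs @ ys @ zs"] by blast
  have finK: "finite K" and cK: "card K = k" using bases[OF K] fin finite_subset by auto
  have "card (I - {i}) \<le> card ((I - {i}) \<inter> K)"
    using max[OF I, of "length xs"] xs by (simp add: Int_absorb2 Diff_subset)
  hence "(I - {i}) \<inter> K = I - {i}"
    using finI by (intro card_subset_eq) (auto intro: antisym card_mono)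
  hence sub: "I - {i} \<subseteq> K" by blast
  have take2: "set (take (length xs + length ys) (xs @ ys @ zs)) = (I - {i}) \<union> (J - I)"
    using xs ys by simp
  have "((I - {i}) \<union> (J - I)) \<inter> J = J" using i by auto
  hence "k \<le> card (((I - {i}) \<union> (J - I)) \<inter> K)"
    using max[OF J, of "length xs + length ys"] bases[OF J] unfolding take2 by simp
  hence "((I - {i}) \<union> (J - I)) \<inter> K = K"
    using finK cK by (intro card_subset_eq) (auto intro: antisym card_mono)
  hence sup: "K - (I - {i}) \<subseteq> J - I" by blast
  have "card I = k" "i \<in> I" using bases[OF I] i by auto
  hence "card (K - (I - {i})) = 1"
    using sub finI cK card_gt_0_iff[of I] by (auto simp: card_Diff_subset)
  then obtain j where j: "K - (I - {i}) = {j}" by (auto simp: card_1_singleton_iff)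
  have "insert j (I - {i}) = K" using j sub by blast
  thus "\<exists>j\<in>J - I. insert j (I - {i}) \<in> \<B>" using j sup K by auto
qed (use bases in auto)

abbreviation top_positions :: "nat \<Rightarrow> (nat \<Rightarrow> nat) \<Rightarrow> nat \<Rightarrow> nat set" where
  "top_positions n z k \<equiv> {p \<in> {1..n}. n - k < z p}"

lemma top_positions_eq_inv_image:
  assumes "z permutes {1..n}"
  shows "inv z ` {n - k + 1..n} = top_positions n z k"
proof (intro set_eqI iffI)
  fix p assume "p \<in> inv z ` {n - k + 1..n}"
  then obtain q where q: "q \<in> {n - k + 1..n}" "p = inv z q" by auto
  hence "q \<in> {1..n}" by auto
  hence "inv z q \<in> {1..n}" using permutes_in_image[OF permutes_inv[OF assms], of q] by blast
  thus "p \<in> top_positions n z k" using q by (simp add: permutes_inverses[OF assms])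
next
  fix p assume p: "p \<in> top_positions n z k"
  hence "z p \<in> {1..n}" using permutes_in_image[OF assms, of p] by blast
  hence "z p \<in> {n - k + 1..n}" using p by auto
  moreover have "p = inv z (z p)" by (simp add: permutes_inverses[OF assms])
  ultimately show "p \<in> inv z ` {n - k + 1..n}" by blast
qed

lemma card_top_positions:
  assumes "z permutes {1..n}" "k \<le> n"
  shows "card (top_positions n z k) = k"
proof -
  have "card (inv z ` {n - k + 1..n}) = card {n - k + 1..n}"
    by (intro card_image inj_on_subset[OF permutes_inj[OF permutes_inv[OF assms(1)]]]) simp
  thus ?thesis unfolding top_positions_eq_inv_image[OF assms(1)] using assms(2) by simp
qed

lemma bruhat_matroid_eq:
  assumes "k \<le> n"
  shows "bruhat_matroid n u v k = (\<lambda>z. top_positions n z k) ` bruhat_interval n u v"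
proof -
  have z: "z permutes {1..n}" if "z \<in> bruhat_interval n u v" for z
    using that by (simp add: bruhat_interval_def)
  have "bruhat_matroid n u v k = {I. I \<subseteq> {1..n} \<and> card I = k \<and>
      (\<exists>z\<in>bruhat_interval n u v. I = top_positions n z k)}"
    unfolding bruhat_matroid_def using top_positions_eq_inv_image[OF z] by auto
  also have "\<dots> = (\<lambda>z. top_positions n z k) ` bruhat_interval n u v"
    using card_top_positions[OF z assms] by auto
  finally show ?thesis .
qed

text \<open>
  The entry \<open>z i\<close> is the number of thresholds \<open>n - j\<close> with \<open>1 \<le> j \<le> n\<close> below it. The threshold
  \<open>0\<close> is below every entry and contributes the summand \<open>card A\<close>.
\<close>

lemma sum_eq_top_positions:
  assumes "z permutes {1..n}" "A \<subseteq> {1..n}"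
  shows "sum z A = card A + (\<Sum>j = 1..n - 1. card (A \<inter> top_positions n z j))"
proof -
  have fin: "finite A" using assms(2) finite_subset by blast
  have pt: "z i = 1 + (\<Sum>j = 1..n - 1. if n - j < z i then 1 else 0)" if "i \<in> A" for i
  proof -
    have "z i \<in> {1..n}" using that assms(2) permutes_in_image[OF assms(1)] by blast
    hence zi: "1 \<le> z i" "z i \<le> n" by auto
    have "(\<Sum>j = 1..n - 1. if n - j < z i then 1 else 0) = card {j \<in> {1..n - 1}. n - j < z i}"
      by (simp add: sum.If_cases Int_def)
    also have "{j \<in> {1..n - 1}. n - j < z i} = {n - z i + 1..n - 1}"
      using zi by auto
    also have "card \<dots> = z i - 1" using zi by simp
    finally show ?thesis using zi by simp
  qed
  have "sum z A = (\<Sum>i\<in>A. 1 + (\<Sum>j = 1..n - 1. if n - j < z i then 1 else 0))"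
    by (intro sum.cong refl pt)
  also have "\<dots> = card A + (\<Sum>j = 1..n - 1. \<Sum>i\<in>A. if n - j < z i then 1 else 0)"
    by (subst sum.distrib, subst sum.swap) simp
  also have "(\<lambda>j. \<Sum>i\<in>A. if n - j < z i then 1 else 0) = (\<lambda>j. card (A \<inter> top_positions n z j))"
    using fin assms(2) by (auto simp: sum.If_cases fun_eq_iff intro!: arg_cong[where f = card])
  finally show ?thesis .
qed

text \<open>
  Summation by parts. As every prefix sum is nonpositive, raising the weights of a whole prefix to the
  next weight, and in the end all weights to \<open>b\<close>, can only lower the weighted sum. If the total sum
  is zero, it follows that the weighted sum is nonnegative.
\<close>

lemma sum_weighted_ge:
  fixes g d :: "'a \<Rightarrow> real"
  assumes "sorted (map g as)" "distinct as" "\<And>m. sum d (set (take m as)) \<le> 0"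
  shows "(\<forall>p\<in>set as. g p \<le> b) \<Longrightarrow> b * sum d (set as) \<le> (\<Sum>p\<in>set as. g p * d p)"
  using assms
proof (induction as arbitrary: b rule: rev_induct)
  case (snoc x as)
  have x: "x \<notin> set as" using snoc.prems by simp
  have "sum d (set (take m as)) \<le> 0" for m
    using snoc.prems(4)[of "min m (length as)"] by (simp add: min_def split: if_splits)
  hence "g x * sum d (set as) \<le> (\<Sum>p\<in>set as. g p * d p)"
    using snoc.prems by (intro snoc.IH) (auto simp: sorted_append)
  hence "g x * sum d (set (as @ [x])) \<le> (\<Sum>p\<in>set (as @ [x]). g p * d p)"
    using x by (simp add: algebra_simps)
  moreover have "b * sum d (set (as @ [x])) \<le> g x * sum d (set (as @ [x]))"
    using snoc.prems(1) snoc.prems(4)[of "Suc (length as)"] by (intro mult_right_mono_neg) auto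
  ultimately show ?case by linarith
qed simp

theorem proposition4p26:
  fixes n :: nat and e :: "nat \<Rightarrow> 'n::finite" and u v :: "nat \<Rightarrow> nat"
  assumes "bij_betw e {1..n} UNIV"
    and "u permutes {1..n}" and "v permutes {1..n}" and "bruhat_le n u v"
  shows "(\<forall>k\<in>{1..n - 1}. is_matroid {1..n} k (bruhat_matroid n u v k)) \<and>
    bruhat_interval_polytope n e u v =
      {x :: real ^ 'n.
         (\<Sum>i\<in>{1..n}. x $ e i) = real ((n + 1) choose 2) \<and>
         (\<forall>A. A \<subseteq> {1..n} \<longrightarrow>
            (\<Sum>i\<in>A. x $ e i)
              \<le> real (card A) + (\<Sum>j = 1..n - 1. real (matroid_rank (bruhat_matroid n u v j) A)))}"
    (is "?matroids \<and> _ = ?R")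
proof
  define W where "W = bruhat_interval n u v"
  have perm: "z permutes {1..n}" if "z \<in> W" for z
    using that by (simp add: W_def bruhat_interval_def)
  have finW: "finite W"
    by (rule finite_subset[OF _ finite_permutations[of "{1..n}"]]) (auto simp: W_def bruhat_interval_def)
  have "u \<in> W" using assms by (simp add: W_def bruhat_interval_def bruhat_le_refl)
  have greedy: "\<exists>z\<in>W. \<forall>y\<in>W. \<forall>m k. card (set (take m as) \<inter> top_positions n y k)
      \<le> card (set (take m as) \<inter> top_positions n z k)" if as: "distinct as" "set as = {1..n}" for as
  proof -
    have "set (take m as) \<inter> top_positions n y k = {p \<in> set (take m as). n - k < y p}" for m y k
      using set_take_subset[of m as] as(2) by auto
    moreover obtain z where "z \<in> W" "\<And>y. y \<in> W \<Longrightarrow> prefix_dominates as z y"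
      using bruhat_interval_prefix_maximum[OF as assms(2-4)] unfolding W_def by blast
    ultimately show ?thesis
      by (intro bexI[of _ z]) (simp_all only: prefix_dominates_def ball_simps, blast)
  qed
  have rank_ge: "card (A \<inter> top_positions n z j) \<le> matroid_rank (bruhat_matroid n u v j) A"
    if "z \<in> W" "j \<le> n" for A z j
    unfolding matroid_rank_def bruhat_matroid_eq[OF that(2)] W_def[symmetric]
    using that finW by (intro Max_ge) auto
  have rank_eq: "matroid_rank (bruhat_matroid n u v j) A = card (A \<inter> top_positions n z j)"
    if "z \<in> W" "j \<le> n" "\<And>y. y \<in> W \<Longrightarrow> card (A \<inter> top_positions n y j) \<le> card (A \<inter> top_positions n z j)"
    for A z j
    unfolding matroid_rank_def bruhat_matroid_eq[OF that(2)] W_def[symmetric]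
    using that finW by (intro Max_eqI) auto

  show ?matroids
  proof
    fix k assume "k \<in> {1..n - 1}"
    hence k: "k \<le> n" by auto
    show "is_matroid {1..n} k (bruhat_matroid n u v k)"
      unfolding bruhat_matroid_eq[OF k] W_def[symmetric]
    proof (rule is_matroid_if_prefix_maximum)
      fix as assume "distinct as" "set as = {1..n}"
      thus "\<exists>K\<in>(\<lambda>z. top_positions n z k) ` W. \<forall>J\<in>(\<lambda>z. top_positions n z k) ` W.
          \<forall>m. card (set (take m as) \<inter> J) \<le> card (set (take m as) \<inter> K)"
        using greedy[of as] by (simp only: ball_simps bex_simps) blast
    next
      fix I assume "I \<in> (\<lambda>z. top_positions n z k) ` W"
      thus "I \<subseteq> {1..n} \<and> card I = k" using card_top_positions[OF perm k] by auto
    qed (use \<open>u \<in> W\<close> in auto)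
  qed

  define vertex :: "(nat \<Rightarrow> nat) \<Rightarrow> real ^ 'n"
    where "vertex z = (\<chi> j. real (z (inv_into {1..n} e j)))" for z
  have vertex: "vertex z $ e i = real (z i)" if "i \<in> {1..n}" for z i
    using that assms(1) by (simp add: vertex_def bij_betw_def inv_into_f_f)
  have coordinate: "\<exists>i\<in>{1..n}. j = e i" for j
    using assms(1) by (auto simp: bij_betw_def)
  have "{y. \<exists>z\<in>W. \<forall>i\<in>{1..n}. y $ e i = real (z i)} = vertex ` W"
  proof (intro set_eqI iffI)
    fix y :: "real ^ 'n" assume "y \<in> {y. \<exists>z\<in>W. \<forall>i\<in>{1..n}. y $ e i = real (z i)}"
    then obtain z where "z \<in> W" "\<forall>i\<in>{1..n}. y $ e i = real (z i)" by auto
    moreover have "y = vertex z"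
      unfolding vec_eq_iff using calculation vertex[of _ z] coordinate by metis
    ultimately show "y \<in> vertex ` W" by blast
  qed (use vertex in auto)
  hence Q: "bruhat_interval_polytope n e u v = convex hull (vertex ` W)"
    by (simp add: bruhat_interval_polytope_def W_def)
  have total: "(\<Sum>i\<in>{1..n}. real (z i)) = real ((n + 1) choose 2)" if "z \<in> W" for z
  proof -
    have "(\<Sum>i\<in>{1..n}. z i) = \<Sum>{1..n}"
      using sum.permute[OF perm[OF that], of id] by simp
    also have "\<dots> = (n + 1) choose 2"
      by (induction n) (simp_all add: numeral_2_eq_2)
    finally show ?thesis by (metis of_nat_sum)
  qed
  have vertex_sum: "(\<Sum>i\<in>A. real (z i)) =
      real (card A) + (\<Sum>j = 1..n - 1. real (card (A \<inter> top_positions n z j)))"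
    if "z \<in> W" "A \<subseteq> {1..n}" for z A
    using arg_cong[OF sum_eq_top_positions[OF perm[OF that(1)] that(2)], of real] by simp

  show "bruhat_interval_polytope n e u v = ?R"
  proof
    have "convex ?R"
    proof (rule convexI)
      fix x y :: "real ^ 'n" and s t :: real
      assume xy: "x \<in> ?R" "y \<in> ?R" and st: "0 \<le> s" "0 \<le> t" "s + t = 1"
      have lin: "(\<Sum>i\<in>A. (s *\<^sub>R x + t *\<^sub>R y) $ e i) = s * (\<Sum>i\<in>A. x $ e i) + t * (\<Sum>i\<in>A. y $ e i)"
        for A by (simp add: sum.distrib sum_distrib_left)
      have "s * a + t * b \<le> c" if "a \<le> c" "b \<le> c" for a b c :: real
        using convex_bound_le[OF that st] .
      moreover have "s * c + t * c = c" for c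
        using st(3) by (metis distrib_right mult_1)
      ultimately show "s *\<^sub>R x + t *\<^sub>R y \<in> ?R"
        using xy unfolding mem_Collect_eq lin by simp
    qed
    moreover have "vertex ` W \<subseteq> ?R"
    proof (intro image_subsetI CollectI conjI allI impI)
      fix z assume z: "z \<in> W"
      show "(\<Sum>i\<in>{1..n}. vertex z $ e i) = real ((n + 1) choose 2)"
        using total[OF z] vertex[of _ z] by simp
      fix A assume A: "A \<subseteq> {1..n}"
      have "(\<Sum>i\<in>A. vertex z $ e i) = (\<Sum>i\<in>A. real (z i))"
        using A by (intro sum.cong refl vertex) auto
      also have "\<dots> \<le> real (card A) + (\<Sum>j = 1..n - 1. real (matroid_rank (bruhat_matroid n u v j) A))"
        unfolding vertex_sum[OF z A] using rank_ge[OF z]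
        by (intro add_left_mono sum_mono of_nat_mono) auto
      finally show "(\<Sum>i\<in>A. vertex z $ e i) \<le>
          real (card A) + (\<Sum>j = 1..n - 1. real (matroid_rank (bruhat_matroid n u v j) A))" .
    qed
    ultimately show "bruhat_interval_polytope n e u v \<subseteq> ?R"
      unfolding Q by (intro hull_minimal)
  next
    show "?R \<subseteq> bruhat_interval_polytope n e u v"
    proof (rule subsetI, rule ccontr)
      fix x assume x: "x \<in> ?R" and "x \<notin> bruhat_interval_polytope n e u v"
      hence notin: "x \<notin> convex hull (vertex ` W)" by (simp only: Q not_False_eq_True)
      have "closed (convex hull (vertex ` W))"
        using finW by (intro compact_imp_closed compact_convex_hull finite_imp_compact) simp
      then obtain a b where ab: "a \<bullet> x < b" "\<And>y. y \<in> convex hull (vertex ` W) \<Longrightarrow> b < a \<bullet> y"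
        using separating_hyperplane_closed_point[OF convex_convex_hull _ notin] by blast
      define g where "g i = a $ e i" for i
      \<comment> \<open>The polytope lies on the side of large values of the functional, so z has to minimize the
        functional: positions with small coefficients come first and receive the large entries.\<close>
      define as where "as = sort_key g [1..<Suc n]"
      have as: "distinct as" "set as = {1..n}" "sorted (map g as)"
        by (auto simp: as_def)
      obtain z where z: "z \<in> W" and max: "\<And>y m k. y \<in> W \<Longrightarrow> card (set (take m as) \<inter> top_positions n y k)
          \<le> card (set (take m as) \<inter> top_positions n z k)"
        using greedy[OF as(1,2)] by blast
      define d where "d i = x $ e i - real (z i)" for i
      have "sum d (set (take m as)) \<le> 0" for m
      proof -
        let ?A = "set (take m as)"
        have A: "?A \<subseteq> {1..n}" using set_take_subset[of m as] as(2) by simp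
        \<comment> \<open>The rank of a prefix is attained at z in all the matroids at once.\<close>
        have "(\<Sum>i\<in>?A. x $ e i) \<le>
            real (card ?A) + (\<Sum>j = 1..n - 1. real (matroid_rank (bruhat_matroid n u v j) ?A))"
          using x A by blast
        also have "\<dots> = (\<Sum>i\<in>?A. real (z i))"
          unfolding vertex_sum[OF z A]
          by (intro arg_cong2[where f = "(+)"] sum.cong refl arg_cong[where f = real] rank_eq z max) auto
        finally show ?thesis by (simp add: d_def sum_subtractf)
      qed
      moreover have "sum d (set as) = 0"
        using x total[OF z] by (simp add: as(2) d_def sum_subtractf)
      moreover have "\<forall>p\<in>set as. g p \<le> Max (g ` set as)" by simp
      ultimately have "0 \<le> (\<Sum>p\<in>{1..n}. g p * d p)"
        using sum_weighted_ge[OF as(3,1), of d "Max (g ` set as)"] by (simp add: as(2))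
      also have "\<dots> = (\<Sum>i\<in>{1..n}. a $ e i * (x - vertex z) $ e i)"
        by (intro sum.cong refl) (simp add: g_def d_def vertex)
      also have "\<dots> = a \<bullet> (x - vertex z)"
        unfolding inner_vec_def using sum.reindex_bij_betw[OF assms(1), of "\<lambda>j. a $ j * (x - vertex z) $ j"]
        by simp
      finally have "a \<bullet> vertex z \<le> a \<bullet> x" by (simp add: inner_diff_right)
      moreover have "vertex z \<in> convex hull (vertex ` W)" using z by (intro hull_inc) simp
      ultimately show False using ab by fastforce
    qed
  qed
qed

end
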